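(* Run PR-SGD-Momentum with Option II (Nesterov's momentum; defined in the context) with momentum coefficient $\beta\in[0,1)$, learning rate $\gamma>0$ and synchronization interval $I$ (a positive integer) on the problem $\min_{\mathbf{x}\in\mathbb{R}^m} f(\mathbf{x})$ satisfying Assumption A (see context), and let $f^\ast$ be the minimum value of $f$. If $\gamma\le\frac{(1-\beta)^2}{L(1+\beta^3)}$ and $I\le\frac{1-\beta}{6L\gamma}$, then for all $T>0$, $$\frac1T\sum_{t=0}^{T-1}\mathbb{E}\big[\|\nabla f(\bar{\mathbf{x}}^{(t)})\|^2\big]\le \frac{2(1-\beta)}{\gamma T}\big(f(\bar{\mathbf{x}}^{(0)})-f^\ast\big)+\frac{L\gamma}{(1-\beta)^2}\frac{\sigma^2}{N}+\frac{4L^2\gamma^2 I\sigma^2}{(1-\beta)^2}+\frac{9L^2\gamma^2I^2\kappa^2}{(1-\beta)^2},$$ and the right-hand side is $O(\frac{1}{\gamma T})+O(\frac{\gamma}{N}\sigma^2)+O(\gamma^2 I\sigma^2)+O(\gamma^2I^2\kappa^2)$.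
   Context: Setting. $N,m\ge1$ are integers and $T$ denotes an integer. For $i\in\{1,\dots,N\}$, $\mathcal{D}_i$ is a probability distribution, $F_i(\mathbf{x};\xi)$ is a real-valued function differentiable in $\mathbf{x}\in\mathbb{R}^m$, $f_i(\mathbf{x})=\mathbb{E}_{\xi\sim\mathcal{D}_i}[F_i(\mathbf{x};\xi)]$, and $f=\frac1N\sum_{i=1}^N f_i$. Stochastic gradients are unbiased: $\mathbb{E}_{\xi\sim\mathcal{D}_i}[\nabla F_i(\mathbf{x};\xi)]=\nabla f_i(\mathbf{x})$. $\|\cdot\|$ is the Euclidean norm. Assumption A. (1) Each $f_i$ is smooth with modulus $L>0$, i.e. differentiable with $L$-Lipschitz gradient. (2) There are constants $\sigma>0$, $\kappa>0$ with $\mathbb{E}_{\xi\sim\mathcal{D}_i}[\|\nabla F_i(\mathbf{x};\xi)-\nabla f_i(\mathbf{x})\|^2]\le\sigma^2$ for all $i,\mathbf{x}$, and $\frac1N\sum_{i=1}^N\|\nabla f_i(\mathbf{x})-\nabla f(\mathbf{x})\|^2\le\kappa^2$ for all $\mathbf{x}$. PR-SGD-Momentum, Option II. Initialize $\mathbf{x}_i^{(0)}=\hat{\mathbf{x}}\in\mathbb{R}^m$ (the same deterministic point for all $i$) and $\mathbf{u}_i^{(0)}=\mathbf{0}$. For $t=1,2,\dots$: each worker $i$ draws $\xi_i^{(t-1)}\sim\mathcal{D}_i$ (independently over workers and iterations), sets $\mathbf{g}_i^{(t-1)}=\nabla F_i(\mathbf{x}_i^{(t-1)};\xi_i^{(t-1)})$,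 and updates $\mathbf{u}_i^{(t)}=\beta\mathbf{u}_i^{(t-1)}+\mathbf{g}_i^{(t-1)}$, $\mathbf{v}_i^{(t)}=\beta\mathbf{u}_i^{(t)}+\mathbf{g}_i^{(t-1)}$, $\mathbf{x}_i^{(t)}=\mathbf{x}_i^{(t-1)}-\gamma\mathbf{v}_i^{(t)}$. If $t$ is a multiple of $I$, then all workers reset $\mathbf{u}_i^{(t)}$ to $\frac1N\sum_{j=1}^N\mathbf{u}_j^{(t)}$ and $\mathbf{x}_i^{(t)}$ to $\frac1N\sum_{j=1}^N\mathbf{x}_j^{(t)}$. Denote $\bar{\mathbf{x}}^{(t)}=\frac1N\sum_{i=1}^N\mathbf{x}_i^{(t)}$. In the $O(\cdot)$ expression the hidden constants depend only on $L$, $\beta$ and $f(\bar{\mathbf{x}}^{(0)})-f^\ast$. *)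

theory Defs
  imports "HOL-Probability.Probability" "HOL-Library.Landau_Symbols"
    "HOL-Library.Set_Algebras" "HOL-Library.Function_Algebras"
begin

text \<open>
  The value is meaningful only at points of differentiability; see
  \<open>gderiv_gradient\<close> below.
\<close>
definition gradient :: "('a::real_inner \<Rightarrow> real) \<Rightarrow> 'a \<Rightarrow> 'a" where
  "gradient f x = (THE g. GDERIV f x :> g)"

lemma gderiv_unique:
  assumes "GDERIV f x :> g" "GDERIV f x :> h"
  shows "g = h"
proof -
  have "(\<lambda>k. k \<bullet> g) = (\<lambda>k. k \<bullet> h)"
    using assms unfolding gderiv_def by (rule has_derivative_unique)
  hence "(g - h) \<bullet> g = (g - h) \<bullet> h"
    by (rule fun_cong)
  hence "(g - h) \<bullet> (g - h) = 0"
    by (simp add: inner_diff_right)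
  thus ?thesis by simp
qed

lemma gradient_eqI: "GDERIV f x :> g \<Longrightarrow> gradient f x = g"
  unfolding gradient_def by (blast intro: gderiv_unique)

lemma gderiv_gradient:
  fixes f :: "'a::euclidean_space \<Rightarrow> real"
  assumes "f differentiable (at x)"
  shows "GDERIV f x :> gradient f x"
proof -
  obtain f' where f': "(f has_derivative f') (at x)"
    using assms unfolding differentiable_def by blast
  interpret f': bounded_linear f' using f' by (rule has_derivative_bounded_linear)
  define g where "g = (\<Sum>b\<in>Basis. f' b *\<^sub>R b)"
  have "f' h = h \<bullet> g" for h
  proof -
    have "f' h = f' (\<Sum>b\<in>Basis. (h \<bullet> b) *\<^sub>R b)" by (simp add: euclidean_representation)
    also have "\<dots> = (\<Sum>b\<in>Basis. (h \<bullet> b) * f' b)" by (simp add: f'.sum f'.scaleR)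
    also have "\<dots> = h \<bullet> g" by (simp add: g_def inner_sum_right mult.commute)
    finally show ?thesis .
  qed
  hence "f' = (\<lambda>h. h \<bullet> g)" by blast
  hence "GDERIV f x :> g" using f' unfolding gderiv_def by simp
  thus ?thesis using gradient_eqI by metis
qed

definition local_objective ::
    "(nat \<Rightarrow> 's measure) \<Rightarrow> (nat \<Rightarrow> 'a \<Rightarrow> 's \<Rightarrow> real) \<Rightarrow> nat \<Rightarrow> 'a \<Rightarrow> real" where
  "local_objective D F i x = (\<integral>\<xi>. F i x \<xi> \<partial>D i)"

definition worker_avg :: "nat \<Rightarrow> (nat \<Rightarrow> 'a::real_vector) \<Rightarrow> 'a" where
  "worker_avg N y = (1 / real N) *\<^sub>R (\<Sum>i = 1..N. y i)"

definition global_objective ::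
    "nat \<Rightarrow> (nat \<Rightarrow> 's measure) \<Rightarrow> (nat \<Rightarrow> 'a \<Rightarrow> 's \<Rightarrow> real) \<Rightarrow> 'a \<Rightarrow> real" where
  "global_objective N D F x = worker_avg N (\<lambda>i. local_objective D F i x)"

text \<open>
  PR-SGD-Momentum with Nesterov's momentum, run on one realization \<open>s\<close> of the samples
  (\<open>s i t\<close> is the sample worker \<open>i\<close> draws for its stochastic gradient at iterate \<open>t\<close>).
  The result after \<open>t\<close> iterations is the pair of the momentum buffers and the iterates of
  all workers, after the averaging that takes place when \<open>t\<close> is a multiple of \<open>I\<close>.
\<close>
primrec nesterov_state ::
    "nat \<Rightarrow> nat \<Rightarrow> real \<Rightarrow> real \<Rightarrow> (nat \<Rightarrow> 'a \<Rightarrow> 's \<Rightarrow> real) \<Rightarrow> 'a::real_inner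
      \<Rightarrow> (nat \<Rightarrow> nat \<Rightarrow> 's) \<Rightarrow> nat \<Rightarrow> (nat \<Rightarrow> 'a) \<times> (nat \<Rightarrow> 'a)" where
  "nesterov_state N I \<beta> \<gamma> F xhat s 0 = ((\<lambda>i. 0), (\<lambda>i. xhat))"
| "nesterov_state N I \<beta> \<gamma> F xhat s (Suc t) =
    (let (u, x) = nesterov_state N I \<beta> \<gamma> F xhat s t;
         g = (\<lambda>i. gradient (\<lambda>y. F i y (s i t)) (x i));
         u' = (\<lambda>i. \<beta> *\<^sub>R u i + g i);
         v' = (\<lambda>i. \<beta> *\<^sub>R u' i + g i);
         x' = (\<lambda>i. x i - \<gamma> *\<^sub>R v' i)
     in if I dvd Suc t then ((\<lambda>i. worker_avg N u'), (\<lambda>i. worker_avg N x'))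
        else (u', x'))"

definition avg_iterate ::
    "nat \<Rightarrow> nat \<Rightarrow> real \<Rightarrow> real \<Rightarrow> (nat \<Rightarrow> 'a \<Rightarrow> 's \<Rightarrow> real) \<Rightarrow> 'a::real_inner
      \<Rightarrow> (nat \<Rightarrow> nat \<Rightarrow> 's) \<Rightarrow> nat \<Rightarrow> 'a" where
  "avg_iterate N I \<beta> \<gamma> F xhat s t = worker_avg N (snd (nesterov_state N I \<beta> \<gamma> F xhat s t))"

lemma avg_iterate_0:
  assumes "N \<ge> 1"
  shows "avg_iterate N I \<beta> \<gamma> F xhat s 0 = xhat"
  using assms by (simp add: avg_iterate_def worker_avg_def scaleR_conv_of_real sum_constant_scaleR)

definition nesterov_bound ::
    "real \<Rightarrow> real \<Rightarrow> real \<Rightarrow> real \<Rightarrow> nat \<Rightarrow> nat \<Rightarrow> nat \<Rightarrow> real \<Rightarrow> real \<Rightarrow> real" where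
  "nesterov_bound L \<beta> \<Delta> \<gamma> T N I \<sigma> \<kappa> =
     2 * (1 - \<beta>) / (\<gamma> * real T) * \<Delta>
     + L * \<gamma> / (1 - \<beta>)\<^sup>2 * (\<sigma>\<^sup>2 / real N)
     + 4 * L\<^sup>2 * \<gamma>\<^sup>2 * real I * \<sigma>\<^sup>2 / (1 - \<beta>)\<^sup>2
     + 9 * L\<^sup>2 * \<gamma>\<^sup>2 * (real I)\<^sup>2 * \<kappa>\<^sup>2 / (1 - \<beta>)\<^sup>2"

text \<open>
  The parameters over which the hidden constants of the \<open>O\<close>-expression have to be uniform,
  for fixed \<open>L\<close> and \<open>\<beta>\<close>. With the filter \<open>principal S\<close>, Landau's \<open>O[principal S](g)\<close>
  consists of the \<open>h\<close> with \<open>\<bar>h p\<bar> \<le> c * \<bar>g p\<bar>\<close> for all \<open>p \<in> S\<close>, for some constant \<open>c\<close>.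
\<close>
definition admissible_params ::
    "real \<Rightarrow> real \<Rightarrow> (real \<times> nat \<times> nat \<times> nat \<times> real \<times> real) set" where
  "admissible_params L \<beta> = {(\<gamma>, T, N, I, \<sigma>, \<kappa>).
     \<gamma> > 0 \<and> T \<ge> 1 \<and> N \<ge> 1 \<and> I \<ge> 1 \<and> \<sigma> > 0 \<and> \<kappa> > 0 \<and>
     \<gamma> \<le> (1 - \<beta>)\<^sup>2 / (L * (1 + \<beta> ^ 3)) \<and> real I \<le> (1 - \<beta>) / (6 * L * \<gamma>)}"

end

theory Submission
  imports Defs
begin

text \<open>
  Write \<open>u\<^sub>t\<close>, \<open>x\<^sub>t\<close>, \<open>g\<^sub>t\<close> for the averages over the workers of the momentum buffers, the iterates
  and the stochastic gradients, and \<open>h\<^sub>t\<close> for the average of the exact local gradients at the local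
  iterates, so that \<open>g\<^sub>t - h\<^sub>t\<close> is averaged noise. Synchronization does not change averages, hence
  \<open>u\<^sub>t\<^sub>+\<^sub>1 = \<beta> u\<^sub>t + g\<^sub>t\<close> and \<open>x\<^sub>t\<^sub>+\<^sub>1 = x\<^sub>t - \<gamma> (\<beta>\<^sup>2 u\<^sub>t + (1 + \<beta>) g\<^sub>t)\<close> hold for every \<open>t\<close>. The shifted
  sequence \<open>z\<^sub>t = x\<^sub>t - \<gamma> \<beta>\<^sup>2 / (1 - \<beta>) u\<^sub>t\<close> (\<open>aux\<close>) is chosen such that the momentum cancels:
  \<open>z\<^sub>t\<^sub>+\<^sub>1 = z\<^sub>t - \<gamma> / (1 - \<beta>) g\<^sub>t\<close>. It runs plain stochastic gradient descent with step
  \<open>\<gamma> / (1 - \<beta>)\<close>, and the quadratic upper bound for smooth functions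
  (\<open>lipschitz_gradient_descent\<close>) can be summed along it (\<open>objective_decrease_along_aux\<close>).

  Three errors have to be paid for. First, the noise of \<open>g\<^sub>t\<close>: it is orthogonal to everything
  that is determined by the earlier samples, and the noises of different workers are orthogonal
  to each other, so it contributes \<open>\<sigma>\<^sup>2 / N\<close> per iteration (\<open>integral_norm_sq_sgrad_avg_le\<close>).
  Second, the gradient is taken at \<open>z\<^sub>t\<close> and not at \<open>x\<^sub>t\<close>: the distance is a multiple of \<open>u\<^sub>t\<close>, whose
  squares sum to at most \<open>(1 - \<beta>)\<^sup>-\<^sup>2\<close> times those of \<open>g\<^sub>t\<close> (\<open>sum_norm_mom_avg_sq_le\<close>). Third, \<open>h\<^sub>t\<close>
  is not the gradient of \<open>f\<close> at \<open>x\<^sub>t\<close>, because the local iterates differ from \<open>x\<^sub>t\<close>. Their mean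
  squared distance, the drift, is created anew in every round of \<open>I\<close> iterations. Unrolling the
  dynamics from the last synchronization expresses it through the noise and through the
  dispersion of the local gradients. The dispersion in an iteration is at most \<open>2 \<kappa>\<^sup>2\<close>
  plus a multiple of the drift in that iteration. So the drift is bounded through the drift earlier
  in the round, and the condition on \<open>I\<close> makes the multiple small enough for an induction
  (\<open>integral_drift_le\<close>).

  In the sum of all contributions (\<open>average_gradient_bound\<close>) the condition on \<open>\<gamma>\<close> says precisely
  that the total coefficient of the squared norms of \<open>h\<^sub>t\<close> is not positive.

  The probabilistic basis is a freezing argument (\<open>integral_inner_fresh_noise_eq_0\<close>): a sample
  that is independent of the past may be integrated out first while the past is held fixed. It
  requires that the stochastic gradient is jointly measurable in the point and the sample, which
  follows from its being a limit of difference quotients (\<open>borel_measurable_gradient_pair\<close>).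
\<close>

section \<open>Gradients of smooth functions\<close>

text \<open>
  Along the segment from \<open>x\<close> to \<open>y\<close>, the difference of the two sides has a nonpositive
  derivative, because the gradient at parameter \<open>s\<close> deviates from the one at \<open>x\<close> by at most
  \<open>L * s * norm (y - x)\<close>.
\<close>
lemma lipschitz_gradient_descent:
  fixes f :: "'a::euclidean_space \<Rightarrow> real"
  assumes diff: "\<And>x. f differentiable (at x)"
    and lip: "L-lipschitz_on UNIV (gradient f)"
  shows "f y \<le> f x + gradient f x \<bullet> (y - x) + L / 2 * (norm (y - x))\<^sup>2"
proof -
  define d where "d = y - x"
  define \<phi> where "\<phi> s = f (x + s *\<^sub>R d) - s * (gradient f x \<bullet> d) - L / 2 * s\<^sup>2 * (norm d)\<^sup>2" for s
  have der: "(\<phi> has_real_derivative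
      (gradient f (x + s *\<^sub>R d) - gradient f x) \<bullet> d - L * s * (norm d)\<^sup>2) (at s)" for s
  proof -
    have "(f has_derivative (\<lambda>h. h \<bullet> gradient f (x + s *\<^sub>R d))) (at (x + s *\<^sub>R d))"
      using gderiv_gradient[OF diff] by (simp add: gderiv_def)
    moreover have "((\<lambda>s. x + s *\<^sub>R d) has_derivative (\<lambda>h. h *\<^sub>R d)) (at s)"
      by (auto intro!: derivative_eq_intros)
    ultimately have "((\<lambda>s. f (x + s *\<^sub>R d)) has_derivative
        (\<lambda>h. (h *\<^sub>R d) \<bullet> gradient f (x + s *\<^sub>R d))) (at s)"
      by (rule has_derivative_compose[rotated])
    hence "((\<lambda>s. f (x + s *\<^sub>R d)) has_real_derivative (d \<bullet> gradient f (x + s *\<^sub>R d))) (at s)"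
      by (rule has_derivative_imp_has_field_derivative) simp
    thus ?thesis
      unfolding \<phi>_def
      by (auto intro!: derivative_eq_intros simp: inner_diff_left inner_diff_right inner_commute)
  qed
  have "\<phi> 1 \<le> \<phi> 0"
  proof (rule DERIV_nonpos_imp_nonincreasing[where f = \<phi>])
    fix s :: real assume "0 \<le> s" "s \<le> 1"
    have "(gradient f (x + s *\<^sub>R d) - gradient f x) \<bullet> d
        \<le> norm (gradient f (x + s *\<^sub>R d) - gradient f x) * norm d"
      by (rule norm_cauchy_schwarz)
    also have "\<dots> \<le> (L * norm (s *\<^sub>R d)) * norm d"
      using lipschitz_onD[OF lip, of "x + s *\<^sub>R d" x]
      by (intro mult_right_mono) (auto simp: dist_norm)
    also have "\<dots> = L * s * (norm d)\<^sup>2"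
      using \<open>0 \<le> s\<close> by (simp add: power2_eq_square)
    finally have "(gradient f (x + s *\<^sub>R d) - gradient f x) \<bullet> d - L * s * (norm d)\<^sup>2 \<le> 0"
      by simp
    thus "\<exists>y. DERIV \<phi> s :> y \<and> y \<le> 0"
      using der by blast
  qed simp
  thus ?thesis
    by (simp add: \<phi>_def d_def)
qed

text \<open>
  The directional derivative is taken along the sequence \<open>1 / (n + 1)\<close> only: a countable limit
  is what preserves measurability in a parameter.
\<close>
lemma difference_quotient_tendsto_gradient:
  fixes f :: "'a::euclidean_space \<Rightarrow> real"
  assumes "f differentiable (at x)"
  shows "(\<lambda>n. real (Suc n) * (f (x + inverse (real (Suc n)) *\<^sub>R b) - f x))
           \<longlonglongrightarrow> gradient f x \<bullet> b"
proof -
  have "(f has_derivative (\<lambda>h. h \<bullet> gradient f x)) (at (x + 0 *\<^sub>R b))"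
    using gderiv_gradient[OF assms] by (simp add: gderiv_def)
  moreover have "((\<lambda>s. x + s *\<^sub>R b) has_derivative (\<lambda>h. h *\<^sub>R b)) (at 0)"
    by (auto intro!: derivative_eq_intros)
  ultimately have "((\<lambda>s. f (x + s *\<^sub>R b)) has_derivative (\<lambda>h. (h *\<^sub>R b) \<bullet> gradient f x)) (at 0)"
    by (rule has_derivative_compose[rotated])
  hence "((\<lambda>s. f (x + s *\<^sub>R b)) has_real_derivative (b \<bullet> gradient f x)) (at 0)"
    by (rule has_derivative_imp_has_field_derivative) simp
  hence "((\<lambda>h. (f (x + h *\<^sub>R b) - f x) / h) \<longlongrightarrow> gradient f x \<bullet> b) (at 0)"
    by (simp add: DERIV_def inner_commute)
  moreover have "filterlim (\<lambda>n. inverse (real (Suc n))) (at 0) sequentially"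
    by (intro filterlim_atI LIMSEQ_inverse_real_of_nat) auto
  ultimately have "(\<lambda>n. (f (x + inverse (real (Suc n)) *\<^sub>R b) - f x) / inverse (real (Suc n)))
      \<longlonglongrightarrow> gradient f x \<bullet> b"
    by (rule filterlim_compose)
  thus ?thesis by (simp add: field_simps)
qed

text \<open>
  Replacing \<open>x\<close> by approximations \<open>q n x\<close> with finite range makes the function measurable, since
  on each of finitely many pieces it depends on \<open>s\<close> alone. Continuity in \<open>x\<close> recovers the function
  in the limit.
\<close>
lemma borel_measurable_caratheodory:
  fixes G :: "'a::{second_countable_topology, metric_space} \<Rightarrow> 's \<Rightarrow> 'b::metric_space"
  assumes meas: "\<And>x. G x \<in> borel_measurable S"
    and cont: "\<And>s. s \<in> space S \<Longrightarrow> continuous_on UNIV (\<lambda>x. G x s)"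
  shows "(\<lambda>(x, s). G x s) \<in> borel_measurable (borel \<Otimes>\<^sub>M S)"
proof -
  obtain q :: "nat \<Rightarrow> 'a \<Rightarrow> 'a" where q: "\<And>n. simple_function borel (q n)"
    and q_lim: "\<And>x. (\<lambda>n. q n x) \<longlonglongrightarrow> x"
    using borel_measurable_implies_sequence_metric[of "\<lambda>x. x" borel undefined] by auto
  show ?thesis
  proof (rule borel_measurable_LIMSEQ_metric[where f = "\<lambda>n (x, s). G (q n x) s"])
    fix n
    have "(\<lambda>p. (\<lambda>y p. G y (snd p)) (q n (fst p)) p) \<in> borel_measurable (borel \<Otimes>\<^sub>M S)"
    proof (rule measurable_compose_countable'[where f = "\<lambda>y p. G y (snd p)"
          and g = "\<lambda>p. q n (fst p)" and I = "range (q n)"])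
      show "countable (range (q n))"
        using simple_functionD(1)[OF q, of n] by (simp add: countable_finite)
      have "q n \<in> measurable borel (count_space (range (q n)))"
        using measurable_simple_function[OF q[of n]]
        by (auto simp: measurable_count_space_eq2_countable measurable_def
            intro!: simple_functionD[OF q])
      thus "(\<lambda>p. q n (fst p)) \<in> measurable (borel \<Otimes>\<^sub>M S) (count_space (range (q n)))"
        by (rule measurable_compose[OF measurable_fst])
      show "(\<lambda>p. G y (snd p)) \<in> borel_measurable (borel \<Otimes>\<^sub>M S)" for y
        by (rule measurable_compose[OF measurable_snd meas])
    qed
    thus "(\<lambda>(x, s). G (q n x) s) \<in> borel_measurable (borel \<Otimes>\<^sub>M S)"
      by (simp add: split_beta')
  next
    fix p :: "'a \<times> 's" assume "p \<in> space (borel \<Otimes>\<^sub>M S)"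
    hence "isCont (\<lambda>x. G x (snd p)) (fst p)"
      using cont by (auto simp: space_pair_measure continuous_on_eq_continuous_at)
    thus "(\<lambda>n. case p of (x, s) \<Rightarrow> G (q n x) s) \<longlonglongrightarrow> (case p of (x, s) \<Rightarrow> G x s)"
      using isCont_tendsto_compose[OF _ q_lim, of "fst p" "\<lambda>x. G x (snd p)"] by (simp add: split_beta')
  qed
qed

text \<open>
  Joint measurability is what allows a random iterate to be substituted for the point, and what
  Fubini's theorem needs. The difference quotients have it by the previous lemma, and their limits
  are the coordinates of the gradient.
\<close>
lemma borel_measurable_gradient_pair:
  fixes G :: "'a::euclidean_space \<Rightarrow> 's \<Rightarrow> real"
  assumes meas: "\<And>x. G x \<in> borel_measurable S"
    and diff: "\<And>s x. s \<in> space S \<Longrightarrow> (\<lambda>y. G y s) differentiable (at x)"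
  shows "(\<lambda>(x, s). gradient (\<lambda>y. G y s) x) \<in> borel_measurable (borel \<Otimes>\<^sub>M S)"
proof -
  have G: "(\<lambda>(x, s). G x s) \<in> borel_measurable (borel \<Otimes>\<^sub>M S)"
    using diff by (intro borel_measurable_caratheodory meas continuous_at_imp_continuous_on ballI)
      (auto intro: differentiable_imp_continuous_within)
  have shift: "(\<lambda>p. G (fst p + c) (snd p)) \<in> borel_measurable (borel \<Otimes>\<^sub>M S)" for c
  proof -
    have "(\<lambda>p. (fst p + c, snd p)) \<in> measurable (borel \<Otimes>\<^sub>M S) (borel \<Otimes>\<^sub>M S)"
      by measurable
    from measurable_compose[OF this G] show ?thesis by (simp add: split_beta')
  qed
  have "(\<lambda>p. gradient (\<lambda>y. G y (snd p)) (fst p) \<bullet> b) \<in> borel_measurable (borel \<Otimes>\<^sub>M S)" for b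
  proof (rule borel_measurable_LIMSEQ_metric)
    fix n show "(\<lambda>p. real (Suc n) * (G (fst p + inverse (real (Suc n)) *\<^sub>R b) (snd p) - G (fst p) (snd p)))
        \<in> borel_measurable (borel \<Otimes>\<^sub>M S)"
      using shift[of "inverse (real (Suc n)) *\<^sub>R b"] shift[of 0]
      by (intro borel_measurable_times borel_measurable_diff borel_measurable_const) simp_all
  next
    fix p :: "'a \<times> 's" assume "p \<in> space (borel \<Otimes>\<^sub>M S)"
    hence "(\<lambda>y. G y (snd p)) differentiable (at (fst p))"
      by (auto simp: space_pair_measure intro: diff)
    from difference_quotient_tendsto_gradient[OF this]
    show "(\<lambda>n. real (Suc n) * (G (fst p + inverse (real (Suc n)) *\<^sub>R b) (snd p) - G (fst p) (snd p)))
        \<longlonglongrightarrow> gradient (\<lambda>y. G y (snd p)) (fst p) \<bullet> b" .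
  qed
  thus ?thesis
    by (subst borel_measurable_euclidean_space) (simp add: split_beta')
qed

section \<open>Averages over workers\<close>

lemma worker_avg_const: "N \<ge> 1 \<Longrightarrow> worker_avg N (\<lambda>i. c) = c"
  by (simp add: worker_avg_def sum_constant_scaleR)

lemma worker_avg_add: "worker_avg N (\<lambda>i. y i + z i) = worker_avg N y + worker_avg N z"
  by (simp add: worker_avg_def sum.distrib scaleR_add_right)

lemma worker_avg_diff: "worker_avg N (\<lambda>i. y i - z i) = worker_avg N y - worker_avg N z"
  by (simp add: worker_avg_def sum_subtractf scaleR_diff_right)

lemma worker_avg_scaleR: "worker_avg N (\<lambda>i. c *\<^sub>R y i) = c *\<^sub>R worker_avg N y"
  by (simp add: worker_avg_def scaleR_sum_right[symmetric])

lemma worker_avg_mult: "worker_avg N (\<lambda>i. c * y i) = c * worker_avg N y" for c :: real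
  using worker_avg_scaleR[of N c y] by simp

lemma worker_avg_sum: "worker_avg N (\<lambda>i. \<Sum>k\<in>A. y k i) = (\<Sum>k\<in>A. worker_avg N (y k))"
  by (induction A rule: infinite_finite_induct)
     (auto simp: worker_avg_add, auto simp: worker_avg_def)

lemma worker_avg_inner_left: "worker_avg N y \<bullet> z = worker_avg N (\<lambda>i. y i \<bullet> z)"
  by (simp add: worker_avg_def inner_sum_left)

lemma worker_avg_mono:
  fixes y z :: "nat \<Rightarrow> real"
  shows "(\<And>i. i \<in> {1..N} \<Longrightarrow> y i \<le> z i) \<Longrightarrow> worker_avg N y \<le> worker_avg N z"
  by (auto simp: worker_avg_def intro!: divide_right_mono sum_mono)

text \<open>
  The decomposition of a mean square into variance and squared bias: the mixed term vanishes,
  as the deviations from the average have average zero.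
\<close>
lemma worker_avg_sq_deviation:
  fixes y :: "nat \<Rightarrow> 'a::real_inner"
  assumes "N \<ge> 1"
  shows "worker_avg N (\<lambda>i. (norm (y i - c))\<^sup>2)
       = worker_avg N (\<lambda>i. (norm (y i - worker_avg N y))\<^sup>2) + (norm (worker_avg N y - c))\<^sup>2"
proof -
  let ?m = "worker_avg N y"
  have "(norm (y i - c))\<^sup>2 = (norm (y i - ?m))\<^sup>2 + ((y i - ?m) \<bullet> (2 *\<^sub>R (?m - c)) + (norm (?m - c))\<^sup>2)" for i
    by (simp add: power2_norm_eq_inner inner_diff_left inner_diff_right inner_commute)
  moreover have "worker_avg N (\<lambda>i. (y i - ?m) \<bullet> (2 *\<^sub>R (?m - c))) = 0"
    unfolding worker_avg_inner_left[symmetric]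
    by (simp add: worker_avg_diff worker_avg_const[OF assms])
  ultimately show ?thesis
    by (simp add: worker_avg_add worker_avg_const[OF assms])
qed

lemma worker_avg_variance_le:
  fixes y :: "nat \<Rightarrow> 'a::real_inner"
  assumes "N \<ge> 1"
  shows "worker_avg N (\<lambda>i. (norm (y i - worker_avg N y))\<^sup>2) \<le> worker_avg N (\<lambda>i. (norm (y i))\<^sup>2)"
  using worker_avg_sq_deviation[OF assms, of y 0] by simp

lemma norm_worker_avg_sq_le:
  fixes y :: "nat \<Rightarrow> 'a::real_inner"
  assumes "N \<ge> 1"
  shows "(norm (worker_avg N y))\<^sup>2 \<le> worker_avg N (\<lambda>i. (norm (y i))\<^sup>2)"
proof -
  have "0 \<le> worker_avg N (\<lambda>i. (norm (y i - worker_avg N y))\<^sup>2)"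
    by (simp add: worker_avg_def sum_nonneg)
  thus ?thesis using worker_avg_sq_deviation[OF assms, of y 0] by simp
qed

lemma norm_add_sq_le: "(norm (a + b))\<^sup>2 \<le> 2 * (norm a)\<^sup>2 + 2 * (norm b)\<^sup>2" for a b :: "'a::real_inner"
proof -
  have "0 \<le> (norm (a - b))\<^sup>2" by simp
  thus ?thesis
    by (simp add: power2_norm_eq_inner inner_simps inner_commute)
qed

lemma norm_sum_sq_le_card:
  "(norm (\<Sum>k\<in>A. y k))\<^sup>2 \<le> real (card A) * (\<Sum>k\<in>A. (norm (y k))\<^sup>2)"
  for y :: "'i \<Rightarrow> 'a::real_inner"
proof -
  have "(norm (\<Sum>k\<in>A. y k))\<^sup>2 \<le> (\<Sum>k\<in>A. norm (y k))\<^sup>2"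
    by (intro power_mono norm_sum norm_ge_zero)
  also have "\<dots> \<le> (\<Sum>k\<in>A. (norm (y k))\<^sup>2) * real (card A)"
    by (rule sum_squared_le_sum_of_squares)
  finally show ?thesis by (simp add: mult.commute)
qed

section \<open>Square-integrable random vectors\<close>

text \<open>
  Measurability is part of the notion, so that it is preserved along the recursion of the
  iterates together with integrability.
\<close>
definition square_integrable :: "'w measure \<Rightarrow> ('w \<Rightarrow> 'a::euclidean_space) \<Rightarrow> bool" where
  "square_integrable M Y \<longleftrightarrow> Y \<in> borel_measurable M \<and> integrable M (\<lambda>\<omega>. (norm (Y \<omega>))\<^sup>2)"

lemma square_integrable_measurable: "square_integrable M Y \<Longrightarrow> Y \<in> borel_measurable M"
  by (simp add: square_integrable_def)

lemma square_integrable_norm_sq: "square_integrable M Y \<Longrightarrow> integrable M (\<lambda>\<omega>. (norm (Y \<omega>))\<^sup>2)"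
  by (simp add: square_integrable_def)

lemma square_integrable_bound:
  assumes "integrable M h" "Y \<in> borel_measurable M"
    and "\<And>\<omega>. \<omega> \<in> space M \<Longrightarrow> (norm (Y \<omega>))\<^sup>2 \<le> h \<omega>"
  shows "square_integrable M Y"
proof -
  have "integrable M (\<lambda>\<omega>. (norm (Y \<omega>))\<^sup>2)"
    using assms(2,3)
    by (intro Bochner_Integration.integrable_bound[OF assms(1)] AE_I2)
      (auto intro: order_trans[OF _ abs_ge_self])
  thus ?thesis using assms(2) by (simp add: square_integrable_def)
qed

lemma square_integrable_add:
  assumes "square_integrable M Y" "square_integrable M Z"
  shows "square_integrable M (\<lambda>\<omega>. Y \<omega> + Z \<omega>)"
proof (rule square_integrable_bound)
  show "integrable M (\<lambda>\<omega>. 2 * (norm (Y \<omega>))\<^sup>2 + 2 * (norm (Z \<omega>))\<^sup>2)"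
    using assms by (auto simp: square_integrable_def)
  show "(\<lambda>\<omega>. Y \<omega> + Z \<omega>) \<in> borel_measurable M"
    using assms by (auto simp: square_integrable_def)
qed (rule norm_add_sq_le)

lemma square_integrable_scaleR:
  "square_integrable M Y \<Longrightarrow> square_integrable M (\<lambda>\<omega>. c *\<^sub>R Y \<omega>)"
  by (auto simp: square_integrable_def power_mult_distrib)

lemma square_integrable_diff:
  assumes "square_integrable M Y" "square_integrable M Z"
  shows "square_integrable M (\<lambda>\<omega>. Y \<omega> - Z \<omega>)"
  using square_integrable_add[OF assms(1) square_integrable_scaleR[OF assms(2), of "-1"]] by simp

lemma (in finite_measure) square_integrable_const: "square_integrable M (\<lambda>\<omega>. c)"
  by (simp add: square_integrable_def)

lemma square_integrable_sum:
  assumes "\<And>a. a \<in> A \<Longrightarrow> square_integrable M (Y a)"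
  shows "square_integrable M (\<lambda>\<omega>. \<Sum>a\<in>A. Y a \<omega>)"
  using assms
  by (induction A rule: infinite_finite_induct)
     (auto simp: square_integrable_add, simp_all add: square_integrable_def)

lemma square_integrable_worker_avg:
  assumes "\<And>i. i \<in> {1..N} \<Longrightarrow> square_integrable M (Y i)"
  shows "square_integrable M (\<lambda>\<omega>. worker_avg N (\<lambda>i. Y i \<omega>))"
  unfolding worker_avg_def by (intro square_integrable_scaleR square_integrable_sum assms)

lemma (in finite_measure) square_integrable_lipschitz:
  assumes \<phi>: "L-lipschitz_on UNIV \<phi>" and Y: "square_integrable M Y"
  shows "square_integrable M (\<lambda>\<omega>. \<phi> (Y \<omega>))"
proof (rule square_integrable_bound)
  show "integrable M (\<lambda>\<omega>. 2 * (norm (\<phi> 0))\<^sup>2 + 2 * (L\<^sup>2 * (norm (Y \<omega>))\<^sup>2))"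
    using Y by (auto simp: square_integrable_def)
  show "(\<lambda>\<omega>. \<phi> (Y \<omega>)) \<in> borel_measurable M"
    by (rule borel_measurable_continuous_on[OF lipschitz_on_continuous_on[OF \<phi>]
        square_integrable_measurable[OF Y]])
  fix \<omega>
  have "norm (\<phi> (Y \<omega>) - \<phi> 0) \<le> L * norm (Y \<omega>)"
    using lipschitz_onD[OF \<phi>, of "Y \<omega>" 0] by (simp add: dist_norm)
  hence "(norm (\<phi> (Y \<omega>) - \<phi> 0))\<^sup>2 \<le> L\<^sup>2 * (norm (Y \<omega>))\<^sup>2"
    using power_mono[of _ _ 2] by (fastforce simp: power_mult_distrib)
  thus "(norm (\<phi> (Y \<omega>)))\<^sup>2 \<le> 2 * (norm (\<phi> 0))\<^sup>2 + 2 * (L\<^sup>2 * (norm (Y \<omega>))\<^sup>2)"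
    using norm_add_sq_le[of "\<phi> 0" "\<phi> (Y \<omega>) - \<phi> 0"] by simp
qed

lemma integrable_inner_square_integrable:
  assumes "square_integrable M Y" "square_integrable M Z"
  shows "integrable M (\<lambda>\<omega>. Y \<omega> \<bullet> Z \<omega>)"
proof (rule Bochner_Integration.integrable_bound)
  show "integrable M (\<lambda>\<omega>. (norm (Y \<omega>))\<^sup>2 + (norm (Z \<omega>))\<^sup>2)"
    using assms by (simp add: square_integrable_def)
  show "(\<lambda>\<omega>. Y \<omega> \<bullet> Z \<omega>) \<in> borel_measurable M"
    using assms by (auto simp: square_integrable_def)
  have "norm (Y \<omega> \<bullet> Z \<omega>) \<le> norm ((norm (Y \<omega>))\<^sup>2 + (norm (Z \<omega>))\<^sup>2)" for \<omega>
    using Cauchy_Schwarz_ineq2[of "Y \<omega>" "Z \<omega>"] sum_squares_bound[of "norm (Y \<omega>)" "norm (Z \<omega>)"]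
      mult_nonneg_nonneg[OF norm_ge_zero norm_ge_zero, of "Y \<omega>" "Z \<omega>"]
    by simp
  thus "AE \<omega> in M. norm (Y \<omega> \<bullet> Z \<omega>) \<le> norm ((norm (Y \<omega>))\<^sup>2 + (norm (Z \<omega>))\<^sup>2)" by simp
qed

text \<open>
  The Pythagorean theorem in the space of square-integrable random vectors. It is applied across
  workers, where it yields the factor \<open>1 / N\<close>, and across the iterations of a round, where it makes
  the noise grow linearly instead of quadratically with the length of the round.
\<close>
lemma integral_norm_sq_sum_orthogonal:
  assumes fin: "finite A" and sq: "\<And>a. a \<in> A \<Longrightarrow> square_integrable M (Y a)"
    and orth: "\<And>a b. a \<in> A \<Longrightarrow> b \<in> A \<Longrightarrow> a \<noteq> b \<Longrightarrow> (\<integral>\<omega>. Y a \<omega> \<bullet> Y b \<omega> \<partial>M) = 0"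
  shows "(\<integral>\<omega>. (norm (\<Sum>a\<in>A. Y a \<omega>))\<^sup>2 \<partial>M) = (\<Sum>a\<in>A. \<integral>\<omega>. (norm (Y a \<omega>))\<^sup>2 \<partial>M)"
proof -
  have int: "integrable M (\<lambda>\<omega>. Y a \<omega> \<bullet> Y b \<omega>)" if "a \<in> A" "b \<in> A" for a b
    using that sq by (intro integrable_inner_square_integrable)
  have "(\<integral>\<omega>. (norm (\<Sum>a\<in>A. Y a \<omega>))\<^sup>2 \<partial>M) = (\<integral>\<omega>. (\<Sum>a\<in>A. \<Sum>b\<in>A. Y a \<omega> \<bullet> Y b \<omega>) \<partial>M)"
    by (simp add: power2_norm_eq_inner inner_sum_left inner_sum_right)
       (subst sum.swap, simp)
  also have "\<dots> = (\<Sum>a\<in>A. \<Sum>b\<in>A. \<integral>\<omega>. Y a \<omega> \<bullet> Y b \<omega> \<partial>M)"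
    by (simp add: Bochner_Integration.integral_sum int)
  also have "\<dots> = (\<Sum>a\<in>A. \<integral>\<omega>. (norm (Y a \<omega>))\<^sup>2 \<partial>M)"
  proof (rule sum.cong[OF refl])
    fix a assume a: "a \<in> A"
    have "(\<Sum>b\<in>A. \<integral>\<omega>. Y a \<omega> \<bullet> Y b \<omega> \<partial>M) = (\<Sum>b\<in>A. if b = a then \<integral>\<omega>. Y a \<omega> \<bullet> Y a \<omega> \<partial>M else 0)"
      using a orth by (intro sum.cong refl) auto
    thus "(\<Sum>b\<in>A. \<integral>\<omega>. Y a \<omega> \<bullet> Y b \<omega> \<partial>M) = (\<integral>\<omega>. (norm (Y a \<omega>))\<^sup>2 \<partial>M)"
      using a fin by (simp add: power2_norm_eq_inner)
  qed
  finally show ?thesis .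
qed

section \<open>Noise that is independent of the past\<close>

text \<open>
  The sigma-algebra generated by the samples \<open>X j\<close> with \<open>j \<in> J\<close>, as a measure space on the points of
  \<open>M\<close>. Being determined by these samples is then ordinary measurability with respect to it.
\<close>
definition (in prob_space) history ::
    "('i \<Rightarrow> 's measure) \<Rightarrow> ('i \<Rightarrow> 'a \<Rightarrow> 's) \<Rightarrow> 'i set \<Rightarrow> 'a measure" where
  "history D X J = vimage_algebra (space M) (\<lambda>\<omega>. restrict (\<lambda>j. X j \<omega>) J) (PiM J D)"

lemma (in prob_space) measurable_history:
  assumes X: "\<And>j. j \<in> J \<Longrightarrow> X j \<in> measurable M (D j)" and j: "j \<in> J"
  shows "X j \<in> measurable (history D X J) (D j)"
proof -
  have "(\<lambda>\<omega>. restrict (\<lambda>j. X j \<omega>) J) \<in> measurable (history D X J) (PiM J D)"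
    unfolding history_def
    using measurable_space[OF X] by (intro measurable_vimage_algebra1) (auto simp: space_PiM)
  from measurable_compose[OF this measurable_component_singleton[OF j]]
  show ?thesis using j by (simp cong: measurable_cong_simp)
qed

text \<open>
  Independence of a sample from the history of other samples, with the whole history
  represented by the identity map into the coarser sigma-algebra: its joint law with the sample is
  a product. In this form every quantity determined by the history is covered at once.
\<close>
lemma (in prob_space) distr_history_sample:
  assumes indep: "indep_vars D X K" and J: "J \<subseteq> K" and k: "k \<in> K" "k \<notin> J"
  shows "(\<lambda>\<omega>. \<omega>) \<in> measurable M (history D X J)"
    and "distr M (history D X J \<Otimes>\<^sub>M D k) (\<lambda>\<omega>. (\<omega>, X k \<omega>))
       = distr M (history D X J) (\<lambda>\<omega>. \<omega>) \<Otimes>\<^sub>M distr M (D k) (X k)"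
proof -
  let ?R = "\<lambda>B \<omega>. restrict (\<lambda>j. X j \<omega>) B" and ?H = "history D X J"
  have X: "X j \<in> measurable M (D j)" if "j \<in> K" for j
    using indep that by (auto simp: indep_vars_def)
  have R: "?R J \<in> measurable M (PiM J D)"
    using X J by (intro measurable_restrict) auto
  have "indep_var (PiM J D) (?R J) (PiM {k} D) (?R {k})"
    using J k by (intro indep_var_restrict[OF indep]) auto
  hence indep_set: "indep_set (sigma_sets (space M) {?R J -` A \<inter> space M | A. A \<in> sets (PiM J D)})
      (sigma_sets (space M) {?R {k} -` A \<inter> space M | A. A \<in> sets (PiM {k} D)})"
    by (simp add: indep_var_eq)
  have sets_H: "sets ?H = {?R J -` A \<inter> space M | A. A \<in> sets (PiM J D)}"
    unfolding history_def using measurable_space[OF R] by (intro sets_vimage_algebra2) auto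
  have space_H: "space ?H = space M"
    by (simp add: history_def)
  show id: "(\<lambda>\<omega>. \<omega>) \<in> measurable M ?H"
    unfolding history_def using R by (intro measurable_vimage_algebra2) auto
  note pair = measurable_Pair[OF id X[OF k(1)]]
  have prod: "prob (A \<inter> (X k -` B \<inter> space M)) = prob A * prob (X k -` B \<inter> space M)"
    if A: "A \<in> sets ?H" and B: "B \<in> sets (D k)" for A B
  proof -
    have "(\<lambda>f. f k) -` B \<inter> space (PiM {k} D) \<in> sets (PiM {k} D)"
      using measurable_component_singleton[of k "{k}" D] B by (auto intro: measurable_sets)
    moreover have "X k -` B \<inter> space M = ?R {k} -` ((\<lambda>f. f k) -` B \<inter> space (PiM {k} D)) \<inter> space M"
      using measurable_space[OF X[OF k(1)]] by (auto simp: space_PiM)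
    ultimately have "X k -` B \<inter> space M
        \<in> sigma_sets (space M) {?R {k} -` A \<inter> space M | A. A \<in> sets (PiM {k} D)}"
      by (intro sigma_sets.Basic CollectI exI conjI)
    moreover have "A \<in> sigma_sets (space M) {?R J -` A \<inter> space M | A. A \<in> sets (PiM J D)}"
      using A sets_H by (intro sigma_sets.Basic) simp
    ultimately show ?thesis
      using indep_set by (simp add: indep_sets2_eq)
  qed
  interpret H: prob_space "distr M ?H (\<lambda>\<omega>. \<omega>)" by (rule prob_space_distr[OF id])
  interpret S: prob_space "distr M (D k) (X k)" by (rule prob_space_distr[OF X[OF k(1)]])
  show "distr M (?H \<Otimes>\<^sub>M D k) (\<lambda>\<omega>. (\<omega>, X k \<omega>)) = distr M ?H (\<lambda>\<omega>. \<omega>) \<Otimes>\<^sub>M distr M (D k) (X k)"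
  proof (rule pair_measure_eqI[symmetric])
    fix A B assume "A \<in> sets (distr M ?H (\<lambda>\<omega>. \<omega>))" "B \<in> sets (distr M (D k) (X k))"
    hence A: "A \<in> sets ?H" and B: "B \<in> sets (D k)" by auto
    have A_sub: "A \<subseteq> space M" using sets.sets_into_space[OF A] space_H by simp
    have "(\<lambda>\<omega>. (\<omega>, X k \<omega>)) -` (A \<times> B) \<inter> space M = A \<inter> (X k -` B \<inter> space M)"
      by auto
    moreover have "(\<lambda>\<omega>. \<omega>) -` A \<inter> space M = A" using A_sub by auto
    ultimately show "emeasure (distr M ?H (\<lambda>\<omega>. \<omega>)) A * emeasure (distr M (D k) (X k)) B
        = emeasure (distr M (?H \<Otimes>\<^sub>M D k) (\<lambda>\<omega>. (\<omega>, X k \<omega>))) (A \<times> B)"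
      using prod[OF A B] A B
      by (simp add: emeasure_distr[OF pair] emeasure_distr[OF id] emeasure_distr[OF X[OF k(1)]]
          emeasure_eq_measure ennreal_mult'')
  qed (auto intro: H.sigma_finite_measure_axioms S.sigma_finite_measure_axioms
      cong: sets_pair_measure_cong)
qed

text \<open>
  The first argument of \<open>\<psi>\<close> stands for the past, the second for a fresh sample. As the joint law of
  both is a product, the integral can be computed by integrating over the sample first, with the
  past frozen. Hence bounds and centredness that hold for each frozen past carry over, and the
  noise is orthogonal to every vector \<open>Z\<close> that is determined by the past.
\<close>
lemma (in prob_space)
  fixes \<psi> :: "'a \<Rightarrow> 's \<Rightarrow> 'b::euclidean_space"
  assumes id: "(\<lambda>\<omega>. \<omega>) \<in> measurable M P" and X: "X \<in> measurable M S"
    and joint_distr: "distr M (P \<Otimes>\<^sub>M S) (\<lambda>\<omega>. (\<omega>, X \<omega>)) = distr M P (\<lambda>\<omega>. \<omega>) \<Otimes>\<^sub>M distr M S X"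
    and distr_X: "distr M S X = S"
    and \<psi>: "(\<lambda>(\<omega>, s). \<psi> \<omega> s) \<in> borel_measurable (P \<Otimes>\<^sub>M S)"
    and var: "\<And>\<omega>. integrable S (\<lambda>s. (norm (\<psi> \<omega> s))\<^sup>2)"
      "\<And>\<omega>. (\<integral>s. (norm (\<psi> \<omega> s))\<^sup>2 \<partial>S) \<le> v"
  shows square_integrable_fresh_noise: "square_integrable M (\<lambda>\<omega>. \<psi> \<omega> (X \<omega>))"
    and integral_norm_sq_fresh_noise_le: "(\<integral>\<omega>. (norm (\<psi> \<omega> (X \<omega>)))\<^sup>2 \<partial>M) \<le> v"
    and integral_inner_fresh_noise_eq_0:
      "\<And>Z. (\<And>\<omega>. integrable S (\<psi> \<omega>)) \<Longrightarrow> (\<And>\<omega>. (\<integral>s. \<psi> \<omega> s \<partial>S) = 0) \<Longrightarrow>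
        Z \<in> borel_measurable P \<Longrightarrow> square_integrable M Z \<Longrightarrow>
        (\<integral>\<omega>. \<psi> \<omega> (X \<omega>) \<bullet> Z \<omega> \<partial>M) = 0"
proof -
  note [measurable] = \<psi>
  define Q where "Q = distr M P (\<lambda>\<omega>. \<omega>)"
  have pair: "(\<lambda>\<omega>. (\<omega>, X \<omega>)) \<in> measurable M (P \<Otimes>\<^sub>M S)"
    using id X by (rule measurable_Pair)
  have joint: "distr M (P \<Otimes>\<^sub>M S) (\<lambda>\<omega>. (\<omega>, X \<omega>)) = Q \<Otimes>\<^sub>M S"
    using joint_distr distr_X by (simp add: Q_def)
  have sets_Q [measurable_cong]: "sets Q = sets P" by (simp add: Q_def)
  interpret Q: prob_space Q unfolding Q_def by (rule prob_space_distr[OF id])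
  interpret S: prob_space S using prob_space_distr[OF X] distr_X by simp
  interpret QS: pair_prob_space Q S ..
  have v: "0 \<le> v" using order_trans[OF integral_nonneg_AE var(2)] by simp
  have meas: "(\<lambda>\<omega>. \<psi> \<omega> (X \<omega>)) \<in> borel_measurable M"
    using measurable_compose[OF pair \<psi>] by simp
  have "(\<integral>\<^sup>+\<omega>. ennreal ((norm (\<psi> \<omega> (X \<omega>)))\<^sup>2) \<partial>M)
      = (\<integral>\<^sup>+p. ennreal ((norm (case p of (\<omega>, s) \<Rightarrow> \<psi> \<omega> s))\<^sup>2) \<partial>(Q \<Otimes>\<^sub>M S))"
    unfolding joint[symmetric] by (subst nn_integral_distr[OF pair]) (auto simp: split_beta')
  also have "\<dots> = (\<integral>\<^sup>+\<omega>. (\<integral>\<^sup>+s. ennreal ((norm (\<psi> \<omega> s))\<^sup>2) \<partial>S) \<partial>Q)"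
    by (subst S.nn_integral_fst[symmetric]) auto
  also have "\<dots> \<le> (\<integral>\<^sup>+\<omega>. ennreal v \<partial>Q)"
    using var by (intro nn_integral_mono) (subst nn_integral_eq_integral, auto intro: ennreal_leI)
  also have "\<dots> = ennreal v" by (simp add: Q.emeasure_space_1)
  finally have bound: "(\<integral>\<^sup>+\<omega>. ennreal ((norm (\<psi> \<omega> (X \<omega>)))\<^sup>2) \<partial>M) \<le> ennreal v" .
  have int: "integrable M (\<lambda>\<omega>. (norm (\<psi> \<omega> (X \<omega>)))\<^sup>2)"
    using meas bound
    by (intro integrableI_bounded) (auto simp: top_unique intro: order_le_less_trans[OF _ ennreal_less_top])
  show sq: "square_integrable M (\<lambda>\<omega>. \<psi> \<omega> (X \<omega>))"
    using meas int by (simp add: square_integrable_def)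
  show "(\<integral>\<omega>. (norm (\<psi> \<omega> (X \<omega>)))\<^sup>2 \<partial>M) \<le> v"
    using bound v by (subst (asm) nn_integral_eq_integral[OF int]) auto
  fix Z :: "'a \<Rightarrow> 'b"
  assume mean: "\<And>\<omega>. integrable S (\<psi> \<omega>)" "\<And>\<omega>. (\<integral>s. \<psi> \<omega> s \<partial>S) = 0"
    and Z[measurable]: "Z \<in> borel_measurable P" and Z_sq: "square_integrable M Z"
  define \<Phi> where "\<Phi> = (\<lambda>(\<omega>, s). \<psi> \<omega> s \<bullet> Z \<omega>)"
  have \<Phi>[measurable]: "\<Phi> \<in> borel_measurable (P \<Otimes>\<^sub>M S)"
    unfolding \<Phi>_def by measurable
  have "integrable M (\<lambda>\<omega>. \<Phi> (\<omega>, X \<omega>))"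
    using integrable_inner_square_integrable[OF sq Z_sq] by (simp add: \<Phi>_def)
  hence \<Phi>_int: "integrable (Q \<Otimes>\<^sub>M S) \<Phi>"
    unfolding joint[symmetric] by (subst integrable_distr_eq[OF pair]) auto
  have "(\<integral>\<omega>. \<psi> \<omega> (X \<omega>) \<bullet> Z \<omega> \<partial>M) = (\<integral>p. \<Phi> p \<partial>(Q \<Otimes>\<^sub>M S))"
    unfolding joint[symmetric] by (subst integral_distr[OF pair]) (auto simp: \<Phi>_def)
  also have "\<dots> = (\<integral>\<omega>. (\<integral>s. \<Phi> (\<omega>, s) \<partial>S) \<partial>Q)"
    using QS.integral_fst'[OF \<Phi>_int] by simp
  also have "\<dots> = 0"
    using mean by (simp add: \<Phi>_def)
  finally show "(\<integral>\<omega>. \<psi> \<omega> (X \<omega>) \<bullet> Z \<omega> \<partial>M) = 0" .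
qed

section \<open>The averaged objective\<close>

lemma global_objective_gderiv:
  fixes F :: "nat \<Rightarrow> 'a::euclidean_space \<Rightarrow> 's \<Rightarrow> real"
  assumes "\<And>i. i \<in> {1..N} \<Longrightarrow> local_objective D F i differentiable (at x)"
  shows "GDERIV (global_objective N D F) x :>
    worker_avg N (\<lambda>i. gradient (local_objective D F i) x)"
proof -
  have "((\<lambda>x. (1 / real N) *\<^sub>R (\<Sum>i = 1..N. local_objective D F i x)) has_derivative
      (\<lambda>h. (1 / real N) *\<^sub>R (\<Sum>i = 1..N. h \<bullet> gradient (local_objective D F i) x))) (at x)"
    using gderiv_gradient[OF assms]
    by (intro has_derivative_scaleR_right has_derivative_sum) (simp add: gderiv_def)
  moreover have "(\<lambda>h. (1 / real N) *\<^sub>R (\<Sum>i = 1..N. h \<bullet> gradient (local_objective D F i) x))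
      = (\<lambda>h. h \<bullet> worker_avg N (\<lambda>i. gradient (local_objective D F i) x))"
    by (simp add: worker_avg_def inner_sum_right)
  ultimately show ?thesis
    by (simp add: gderiv_def global_objective_def[abs_def] worker_avg_def)
qed

lemma lipschitz_on_worker_avg:
  fixes \<phi> :: "nat \<Rightarrow> 'a::metric_space \<Rightarrow> 'b::real_normed_vector"
  assumes N: "N \<ge> 1" and lip: "\<And>i. i \<in> {1..N} \<Longrightarrow> L-lipschitz_on S (\<phi> i)"
  shows "L-lipschitz_on S (\<lambda>x. worker_avg N (\<lambda>i. \<phi> i x))"
proof (rule lipschitz_onI)
  fix x y assume xy: "x \<in> S" "y \<in> S"
  have "dist (worker_avg N (\<lambda>i. \<phi> i x)) (worker_avg N (\<lambda>i. \<phi> i y))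
      = (1 / real N) * norm (\<Sum>i = 1..N. \<phi> i x - \<phi> i y)"
    unfolding dist_norm worker_avg_def sum_subtractf scaleR_diff_right[symmetric] by simp
  also have "\<dots> \<le> (1 / real N) * (\<Sum>i = 1..N. L * dist x y)"
  proof (rule mult_left_mono)
    show "norm (\<Sum>i = 1..N. \<phi> i x - \<phi> i y) \<le> (\<Sum>i = 1..N. L * dist x y)"
      using lipschitz_onD[OF lip xy] by (intro sum_norm_le) (simp add: dist_norm)
  qed simp
  also have "\<dots> = L * dist x y" using N by simp
  finally show "dist (worker_avg N (\<lambda>i. \<phi> i x)) (worker_avg N (\<lambda>i. \<phi> i y)) \<le> L * dist x y" .
next
  show "0 \<le> L" using lip[of 1] N by (auto intro: lipschitz_on_nonneg)
qed

lemma norm_lipschitz_diff_sq_le: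
  fixes \<phi> :: "'a::real_normed_vector \<Rightarrow> 'b::real_normed_vector"
  assumes "L-lipschitz_on UNIV \<phi>"
  shows "(norm (\<phi> x - \<phi> y))\<^sup>2 \<le> L\<^sup>2 * (norm (x - y))\<^sup>2"
proof -
  have "norm (\<phi> x - \<phi> y) \<le> L * norm (x - y)"
    using lipschitz_onD[OF assms, of x y] by (simp add: dist_norm)
  thus ?thesis
    using power_mono[of "norm (\<phi> x - \<phi> y)" "L * norm (x - y)" 2] by (simp add: power_mult_distrib)
qed

text \<open>
  The price for evaluating each local gradient at the worker's own point instead of a common one.
\<close>
lemma worker_avg_gradient_drift_le:
  fixes \<phi> :: "nat \<Rightarrow> 'a::real_inner \<Rightarrow> 'b::real_inner"
  assumes N: "N \<ge> 1" and lip: "\<And>i. i \<in> {1..N} \<Longrightarrow> L-lipschitz_on UNIV (\<phi> i)"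
  shows "(norm (worker_avg N (\<lambda>i. \<phi> i m) - worker_avg N (\<lambda>i. \<phi> i (y i))))\<^sup>2
       \<le> L\<^sup>2 * worker_avg N (\<lambda>i. (norm (y i - m))\<^sup>2)"
proof -
  have "(norm (worker_avg N (\<lambda>i. \<phi> i m) - worker_avg N (\<lambda>i. \<phi> i (y i))))\<^sup>2
      \<le> worker_avg N (\<lambda>i. (norm (\<phi> i m - \<phi> i (y i)))\<^sup>2)"
    unfolding worker_avg_diff[symmetric] by (rule norm_worker_avg_sq_le[OF N])
  also have "\<dots> \<le> worker_avg N (\<lambda>i. L\<^sup>2 * (norm (y i - m))\<^sup>2)"
    using norm_lipschitz_diff_sq_le[OF lip] by (intro worker_avg_mono) (simp add: norm_minus_commute)
  finally show ?thesis by (simp add: worker_avg_mult)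
qed

text \<open>
  The local gradients differ for two reasons: they are evaluated at different points, and they
  belong to different functions. Splitting \<open>\<phi> i (y i)\<close> at \<open>\<phi> i m\<close> separates the two; the first
  part is centred at its own average, which only makes it smaller.
\<close>
lemma worker_avg_gradient_dispersion_le:
  fixes \<phi> :: "nat \<Rightarrow> 'a::real_inner \<Rightarrow> 'b::real_inner"
  assumes N: "N \<ge> 1" and lip: "\<And>i. i \<in> {1..N} \<Longrightarrow> L-lipschitz_on UNIV (\<phi> i)"
  shows "worker_avg N (\<lambda>i. (norm (\<phi> i (y i) - worker_avg N (\<lambda>i. \<phi> i (y i))))\<^sup>2)
       \<le> 2 * L\<^sup>2 * worker_avg N (\<lambda>i. (norm (y i - m))\<^sup>2)
         + 2 * worker_avg N (\<lambda>i. (norm (\<phi> i m - worker_avg N (\<lambda>i. \<phi> i m)))\<^sup>2)"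
proof -
  define a where "a i = \<phi> i (y i) - \<phi> i m" for i
  have "worker_avg N (\<lambda>i. (norm (\<phi> i (y i) - worker_avg N (\<lambda>i. \<phi> i (y i))))\<^sup>2)
      = worker_avg N (\<lambda>i. (norm ((a i - worker_avg N a) + (\<phi> i m - worker_avg N (\<lambda>i. \<phi> i m))))\<^sup>2)"
    by (simp add: a_def[abs_def] worker_avg_diff)
  also have "\<dots> \<le> worker_avg N (\<lambda>i. 2 * (norm (a i - worker_avg N a))\<^sup>2
      + 2 * (norm (\<phi> i m - worker_avg N (\<lambda>i. \<phi> i m)))\<^sup>2)"
    by (intro worker_avg_mono norm_add_sq_le)
  also have "\<dots> = 2 * worker_avg N (\<lambda>i. (norm (a i - worker_avg N a))\<^sup>2)
      + 2 * worker_avg N (\<lambda>i. (norm (\<phi> i m - worker_avg N (\<lambda>i. \<phi> i m)))\<^sup>2)"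
    by (simp add: worker_avg_add worker_avg_mult)
  also have "worker_avg N (\<lambda>i. (norm (a i - worker_avg N a))\<^sup>2) \<le> worker_avg N (\<lambda>i. (norm (a i))\<^sup>2)"
    by (rule worker_avg_variance_le[OF N])
  also have "\<dots> \<le> worker_avg N (\<lambda>i. L\<^sup>2 * (norm (y i - m))\<^sup>2)"
    unfolding a_def by (intro worker_avg_mono norm_lipschitz_diff_sq_le lip)
  finally show ?thesis by (simp add: worker_avg_mult)
qed

section \<open>The dynamics along one realization of the samples\<close>

locale nesterov_dynamics =
  fixes N I :: nat and \<beta> \<gamma> :: real
    and F :: "nat \<Rightarrow> 'a::euclidean_space \<Rightarrow> 's \<Rightarrow> real" and xhat :: 'a
  assumes N: "N \<ge> 1" and \<beta>: "0 \<le> \<beta>" "\<beta> < 1"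
begin

definition mom :: "(nat \<Rightarrow> nat \<Rightarrow> 's) \<Rightarrow> nat \<Rightarrow> nat \<Rightarrow> 'a" where
  "mom s t = fst (nesterov_state N I \<beta> \<gamma> F xhat s t)"

definition iter :: "(nat \<Rightarrow> nat \<Rightarrow> 's) \<Rightarrow> nat \<Rightarrow> nat \<Rightarrow> 'a" where
  "iter s t = snd (nesterov_state N I \<beta> \<gamma> F xhat s t)"

text \<open>
  The stochastic gradient that worker \<open>i\<close> uses in the step from iterate \<open>t\<close> to iterate \<open>t + 1\<close>.
\<close>
definition sgrad :: "(nat \<Rightarrow> nat \<Rightarrow> 's) \<Rightarrow> nat \<Rightarrow> nat \<Rightarrow> 'a" where
  "sgrad s t i = gradient (\<lambda>y. F i y (s i t)) (iter s t i)"

definition mom_avg :: "(nat \<Rightarrow> nat \<Rightarrow> 's) \<Rightarrow> nat \<Rightarrow> 'a" where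
  "mom_avg s t = worker_avg N (mom s t)"

definition iter_avg :: "(nat \<Rightarrow> nat \<Rightarrow> 's) \<Rightarrow> nat \<Rightarrow> 'a" where
  "iter_avg s t = worker_avg N (iter s t)"

definition sgrad_avg :: "(nat \<Rightarrow> nat \<Rightarrow> 's) \<Rightarrow> nat \<Rightarrow> 'a" where
  "sgrad_avg s t = worker_avg N (sgrad s t)"

lemma mom_0: "mom s 0 i = 0" and iter_0: "iter s 0 i = xhat"
  by (simp_all add: mom_def iter_def)

text \<open>
  The direction \<open>v\<close> of the update is expressed through the buffer before the update:
  \<open>\<beta> (\<beta> u + g) + g = \<beta>\<^sup>2 u + (1 + \<beta>) g\<close>.
\<close>
lemma state_Suc:
  "mom s (Suc t) = (if I dvd Suc t then (\<lambda>i. worker_avg N (\<lambda>i. \<beta> *\<^sub>R mom s t i + sgrad s t i))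
     else (\<lambda>i. \<beta> *\<^sub>R mom s t i + sgrad s t i))"
  "iter s (Suc t) = (if I dvd Suc t
     then (\<lambda>i. worker_avg N (\<lambda>i. iter s t i - \<gamma> *\<^sub>R (\<beta>\<^sup>2 *\<^sub>R mom s t i + (1 + \<beta>) *\<^sub>R sgrad s t i)))
     else (\<lambda>i. iter s t i - \<gamma> *\<^sub>R (\<beta>\<^sup>2 *\<^sub>R mom s t i + (1 + \<beta>) *\<^sub>R sgrad s t i)))"
  unfolding mom_def iter_def sgrad_def
  by (simp_all add: Let_def split_beta algebra_simps power2_eq_square)

lemma mom_avg_0: "mom_avg s 0 = 0" and iter_avg_0: "iter_avg s 0 = xhat"
  using worker_avg_const[OF N] by (simp_all add: mom_avg_def iter_avg_def mom_def iter_def)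

text \<open>
  Averaging is linear and idempotent, so that the averages follow the same recursion in
  iterations with and without synchronization.
\<close>
lemma mom_avg_Suc: "mom_avg s (Suc t) = \<beta> *\<^sub>R mom_avg s t + sgrad_avg s t"
  by (simp add: mom_avg_def sgrad_avg_def state_Suc worker_avg_const[OF N] worker_avg_add
      worker_avg_scaleR)

lemma iter_avg_Suc:
  "iter_avg s (Suc t) = iter_avg s t - \<gamma> *\<^sub>R (\<beta>\<^sup>2 *\<^sub>R mom_avg s t + (1 + \<beta>) *\<^sub>R sgrad_avg s t)"
  by (simp add: mom_avg_def iter_avg_def sgrad_avg_def state_Suc worker_avg_const[OF N]
      worker_avg_add worker_avg_diff worker_avg_scaleR)

text \<open>
  This includes \<open>t = 0\<close>, where all workers start from the same state; every iteration therefore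
  has a synchronized one at most \<open>I - 1\<close> steps before it.
\<close>
lemma synchronized:
  assumes "I dvd t"
  shows "mom s t i = mom_avg s t" "iter s t i = iter_avg s t"
proof -
  have "mom s t i = mom_avg s t \<and> iter s t i = iter_avg s t"
  proof (cases t)
    case 0
    thus ?thesis by (simp add: mom_0 iter_0 mom_avg_0 iter_avg_0)
  next
    case (Suc t')
    thus ?thesis using assms
      by (simp add: mom_avg_def iter_avg_def state_Suc worker_avg_const[OF N])
  qed
  thus "mom s t i = mom_avg s t" "iter s t i = iter_avg s t" by auto
qed

text \<open>
  The coefficient (up to the factor \<open>- \<gamma>\<close>) with which a stochastic gradient has entered the iterate
  \<open>m\<close> steps after it was drawn: once directly, and through the momentum with the factors
  \<open>\<beta>, \<dots>, \<beta> ^ m\<close>.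
\<close>
definition weight :: "nat \<Rightarrow> real" where
  "weight m = (\<Sum>l\<le>m. \<beta> ^ l)"

lemma weight_bounds: "0 \<le> weight m" "weight m \<le> 1 / (1 - \<beta>)" "(weight m)\<^sup>2 \<le> 1 / (1 - \<beta>)\<^sup>2"
proof -
  show w0: "0 \<le> weight m"
    using \<beta> by (simp add: weight_def sum_nonneg)
  have "(1 - \<beta>) * weight m \<le> 1"
    using sum_gp_basic[of \<beta> m] \<beta> by (simp add: weight_def)
  thus w1: "weight m \<le> 1 / (1 - \<beta>)"
    using \<beta> by (simp add: field_simps)
  show "(weight m)\<^sup>2 \<le> 1 / (1 - \<beta>)\<^sup>2"
    using power_mono[OF w1 w0, of 2] by (simp add: power_divide)
qed

text \<open>
  All deviations are zero at the synchronization \<open>t0\<close>, and within the round a worker and the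
  average follow the same linear recursion. So the deviation is the response to the deviations
  \<open>d\<close> of the stochastic gradients. The iterates can only be treated together with the buffers that
  drive them.
\<close>
lemma deviation_in_round:
  fixes s :: "nat \<Rightarrow> nat \<Rightarrow> 's" and t0 i :: nat
  defines "d \<equiv> \<lambda>k. sgrad s (t0 + k) i - sgrad_avg s (t0 + k)"
  assumes sync: "I dvd t0" and j: "j < I"
  shows "mom s (t0 + j) i - mom_avg s (t0 + j) = (\<Sum>k<j. \<beta> ^ (j - Suc k) *\<^sub>R d k)"
    and "iter s (t0 + j) i - iter_avg s (t0 + j) = - (\<gamma> *\<^sub>R (\<Sum>k<j. weight (j - k) *\<^sub>R d k))"
proof -
  have "mom s (t0 + j) i - mom_avg s (t0 + j) = (\<Sum>k<j. \<beta> ^ (j - Suc k) *\<^sub>R d k)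
      \<and> iter s (t0 + j) i - iter_avg s (t0 + j) = - (\<gamma> *\<^sub>R (\<Sum>k<j. weight (j - k) *\<^sub>R d k))"
    using j
  proof (induction j)
    case 0
    show ?case using synchronized[OF sync] by simp
  next
    case (Suc j)
    let ?U = "mom s (t0 + j) i - mom_avg s (t0 + j)" and ?X = "iter s (t0 + j) i - iter_avg s (t0 + j)"
    have IH: "?U = (\<Sum>k<j. \<beta> ^ (j - Suc k) *\<^sub>R d k)"
      "?X = - (\<gamma> *\<^sub>R (\<Sum>k<j. weight (j - k) *\<^sub>R d k))"
      using Suc by auto
    have no_sync: "\<not> I dvd Suc (t0 + j)"
      using sync Suc.prems nat_dvd_not_less[of "Suc j" I]
      by (metis add_Suc_right dvd_add_right_iff zero_less_Suc)
    have "mom s (t0 + Suc j) i - mom_avg s (t0 + Suc j) = \<beta> *\<^sub>R ?U + d j"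
      using no_sync by (simp add: state_Suc mom_avg_Suc d_def scaleR_diff_right)
    also have "\<beta> *\<^sub>R ?U = (\<Sum>k<j. \<beta> ^ (Suc j - Suc k) *\<^sub>R d k)"
      unfolding IH scaleR_sum_right
      by (intro sum.cong refl) (simp add: power_Suc[symmetric] Suc_diff_Suc del: power_Suc)
    finally have mom: "mom s (t0 + Suc j) i - mom_avg s (t0 + Suc j)
        = (\<Sum>k<Suc j. \<beta> ^ (Suc j - Suc k) *\<^sub>R d k)"
      by simp
    have "iter s (t0 + Suc j) i - iter_avg s (t0 + Suc j)
        = ?X - \<gamma> *\<^sub>R (\<beta>\<^sup>2 *\<^sub>R ?U + (1 + \<beta>) *\<^sub>R d j)"
      using no_sync by (simp add: state_Suc iter_avg_Suc d_def algebra_simps)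
    also have "\<dots> = - (\<gamma> *\<^sub>R ((\<Sum>k<j. weight (j - k) *\<^sub>R d k + \<beta>\<^sup>2 *\<^sub>R \<beta> ^ (j - Suc k) *\<^sub>R d k)
        + (1 + \<beta>) *\<^sub>R d j))"
      unfolding IH scaleR_sum_right[symmetric] sum.distrib by (simp add: algebra_simps)
    also have "(\<Sum>k<j. weight (j - k) *\<^sub>R d k + \<beta>\<^sup>2 *\<^sub>R \<beta> ^ (j - Suc k) *\<^sub>R d k)
        = (\<Sum>k<j. weight (Suc j - k) *\<^sub>R d k)"
    proof (intro sum.cong refl)
      \<comment> \<open>the weight for one more step has the additional summand \<open>\<beta> ^ (j - k + 1)\<close>\<close>
      fix k assume "k \<in> {..<j}"
      then obtain l where "j = Suc (k + l)" using less_imp_Suc_add[of k j] by auto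
      thus "weight (j - k) *\<^sub>R d k + \<beta>\<^sup>2 *\<^sub>R \<beta> ^ (j - Suc k) *\<^sub>R d k = weight (Suc j - k) *\<^sub>R d k"
        by (simp add: weight_def Suc_diff_le power2_eq_square algebra_simps)
    qed
    finally have "iter s (t0 + Suc j) i - iter_avg s (t0 + Suc j)
        = - (\<gamma> *\<^sub>R (\<Sum>k<Suc j. weight (Suc j - k) *\<^sub>R d k))"
      by (simp add: weight_def)
    thus ?case using mom by blast
  qed
  thus "mom s (t0 + j) i - mom_avg s (t0 + j) = (\<Sum>k<j. \<beta> ^ (j - Suc k) *\<^sub>R d k)"
    "iter s (t0 + j) i - iter_avg s (t0 + j) = - (\<gamma> *\<^sub>R (\<Sum>k<j. weight (j - k) *\<^sub>R d k))"
    by auto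
qed

definition drift :: "(nat \<Rightarrow> nat \<Rightarrow> 's) \<Rightarrow> nat \<Rightarrow> real" where
  "drift s t = worker_avg N (\<lambda>i. (norm (iter s t i - iter_avg s t))\<^sup>2)"

text \<open>
  The noise \<open>n\<close> stays inside one weighted sum per worker, so that orthogonality can be exploited
  after taking expectations. The exact gradients \<open>h\<close> of different iterations are correlated, and
  for them the Cauchy-Schwarz inequality costs the factor \<open>j\<close>.
\<close>
lemma drift_le_noise_plus_dispersion:
  assumes split: "\<And>t i. sgrad s t i = n t i + h t i"
    and sync: "I dvd t0" and j: "j < I"
  shows "drift s (t0 + j)
    \<le> 2 * \<gamma>\<^sup>2 * worker_avg N (\<lambda>i. (norm (\<Sum>k<j. weight (j - k) *\<^sub>R n (t0 + k) i))\<^sup>2)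
      + 2 * \<gamma>\<^sup>2 * real j / (1 - \<beta>)\<^sup>2 *
        (\<Sum>k<j. worker_avg N (\<lambda>i. (norm (h (t0 + k) i - worker_avg N (h (t0 + k))))\<^sup>2))"
proof -
  define A where "A i = (\<Sum>k<j. weight (j - k) *\<^sub>R n (t0 + k) i)" for i
  define e where "e k i = h (t0 + k) i - worker_avg N (h (t0 + k))" for k i
  define B where "B i = (\<Sum>k<j. weight (j - k) *\<^sub>R e k i)" for i
  have A_avg: "worker_avg N A = (\<Sum>k<j. weight (j - k) *\<^sub>R worker_avg N (n (t0 + k)))"
    unfolding A_def[abs_def] by (simp add: worker_avg_sum worker_avg_scaleR)
  have sgrad_avg: "sgrad_avg s t = worker_avg N (n t) + worker_avg N (h t)" for t
    unfolding sgrad_avg_def worker_avg_add[symmetric] split[symmetric] ..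
  have dev: "iter s (t0 + j) i - iter_avg s (t0 + j) = - (\<gamma> *\<^sub>R ((A i - worker_avg N A) + B i))" for i
    unfolding deviation_in_round(2)[OF sync j] split sgrad_avg A_avg A_def B_def e_def
      sum_subtractf[symmetric] sum.distrib[symmetric]
    by (simp add: algebra_simps)
  have B: "(norm (B i))\<^sup>2 \<le> real j / (1 - \<beta>)\<^sup>2 * (\<Sum>k<j. (norm (e k i))\<^sup>2)" for i
  proof -
    have "(norm (B i))\<^sup>2 \<le> real j * (\<Sum>k<j. (norm (weight (j - k) *\<^sub>R e k i))\<^sup>2)"
      unfolding B_def using norm_sum_sq_le_card[of "\<lambda>k. weight (j - k) *\<^sub>R e k i" "{..<j}"]
      by (simp del: norm_scaleR)
    also have "\<dots> = real j * (\<Sum>k<j. (weight (j - k))\<^sup>2 * (norm (e k i))\<^sup>2)"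
      by (simp add: power_mult_distrib)
    also have "\<dots> \<le> real j * (\<Sum>k<j. 1 / (1 - \<beta>)\<^sup>2 * (norm (e k i))\<^sup>2)"
      by (intro mult_left_mono sum_mono mult_right_mono weight_bounds) auto
    finally show ?thesis by (simp add: sum_distrib_left[symmetric] sum_divide_distrib[symmetric])
  qed
  have "drift s (t0 + j) = worker_avg N (\<lambda>i. \<gamma>\<^sup>2 * (norm ((A i - worker_avg N A) + B i))\<^sup>2)"
    unfolding drift_def dev by (simp add: power_mult_distrib)
  also have "\<dots> \<le> worker_avg N (\<lambda>i. \<gamma>\<^sup>2 * (2 * (norm (A i - worker_avg N A))\<^sup>2
      + 2 * (real j / (1 - \<beta>)\<^sup>2 * (\<Sum>k<j. (norm (e k i))\<^sup>2))))"
    by (intro worker_avg_mono mult_left_mono order_trans[OF norm_add_sq_le] add_left_mono B) auto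
  also have "\<dots> = 2 * \<gamma>\<^sup>2 * worker_avg N (\<lambda>i. (norm (A i - worker_avg N A))\<^sup>2)
      + 2 * \<gamma>\<^sup>2 * real j / (1 - \<beta>)\<^sup>2 * (\<Sum>k<j. worker_avg N (\<lambda>i. (norm (e k i))\<^sup>2))"
    by (simp only: worker_avg_mult worker_avg_add worker_avg_sum) (simp add: algebra_simps)
  also have "worker_avg N (\<lambda>i. (norm (A i - worker_avg N A))\<^sup>2) \<le> worker_avg N (\<lambda>i. (norm (A i))\<^sup>2)"
    by (rule worker_avg_variance_le[OF N])
  finally show ?thesis
    by (simp add: A_def e_def mult_left_mono)
qed

text \<open>
  The coefficient of the momentum is the one for which the momentum cancels in \<open>aux_Suc\<close> below:
  the sequence performs plain gradient steps of size \<open>\<gamma> / (1 - \<beta>)\<close>.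
\<close>
definition aux :: "(nat \<Rightarrow> nat \<Rightarrow> 's) \<Rightarrow> nat \<Rightarrow> 'a" where
  "aux s t = iter_avg s t - (\<gamma> * \<beta>\<^sup>2 / (1 - \<beta>)) *\<^sub>R mom_avg s t"

lemma aux_0: "aux s 0 = xhat"
  by (simp add: aux_def iter_avg_0 mom_avg_0)

lemma aux_Suc: "aux s (Suc t) = aux s t - (\<gamma> / (1 - \<beta>)) *\<^sub>R sgrad_avg s t"
proof -
  let ?c = "\<gamma> * \<beta>\<^sup>2 / (1 - \<beta>)"
  have c: "\<gamma> * \<beta>\<^sup>2 + ?c * \<beta> = ?c" "\<gamma> * (1 + \<beta>) + ?c = \<gamma> / (1 - \<beta>)"
    using \<beta> by (simp_all add: field_simps power2_eq_square)
  have "aux s (Suc t) = iter_avg s t - (\<gamma> * \<beta>\<^sup>2 + ?c * \<beta>) *\<^sub>R mom_avg s t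
      - (\<gamma> * (1 + \<beta>) + ?c) *\<^sub>R sgrad_avg s t"
    unfolding aux_def iter_avg_Suc mom_avg_Suc by (simp add: algebra_simps)
  thus ?thesis unfolding c by (simp add: aux_def)
qed

text \<open>
  The recursion \<open>u' = \<beta> u + (1 - \<beta>) (g / (1 - \<beta>))\<close> is a convex combination, so convexity of the
  square bounds the squared norms by a linear recursion with contraction factor \<open>\<beta>\<close>.
\<close>
lemma sum_norm_mom_avg_sq_le:
  "(\<Sum>t<T. (norm (mom_avg s t))\<^sup>2) \<le> (\<Sum>t<T. (norm (sgrad_avg s t))\<^sup>2) / (1 - \<beta>)\<^sup>2"
proof -
  define a where "a t = (norm (mom_avg s t))\<^sup>2" for t
  define q where "q t = (norm (sgrad_avg s t))\<^sup>2" for t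
  have step: "a (Suc t) \<le> \<beta> * a t + q t / (1 - \<beta>)" for t
  proof -
    define x where "x = norm (mom_avg s t)"
    define y where "y = norm (sgrad_avg s t) / (1 - \<beta>)"
    have "norm (mom_avg s (Suc t)) \<le> \<beta> * x + (1 - \<beta>) * y"
      using norm_triangle_ineq[of "\<beta> *\<^sub>R mom_avg s t" "sgrad_avg s t"] \<beta>
      by (simp add: mom_avg_Suc x_def y_def)
    hence "a (Suc t) \<le> (\<beta> * x + (1 - \<beta>) * y)\<^sup>2"
      unfolding a_def by (intro power_mono) auto
    also have "\<dots> = \<beta> * x\<^sup>2 + (1 - \<beta>) * y\<^sup>2 - \<beta> * (1 - \<beta>) * (x - y)\<^sup>2"
      by (simp add: power2_eq_square algebra_simps)
    also have "\<dots> \<le> \<beta> * x\<^sup>2 + (1 - \<beta>) * y\<^sup>2" using \<beta> by simp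
    also have "(1 - \<beta>) * y\<^sup>2 = q t / (1 - \<beta>)"
      using \<beta> by (simp add: y_def q_def power2_eq_square)
    finally show ?thesis by (simp add: x_def a_def)
  qed
  \<comment> \<open>the summand \<open>a T\<close> carries the induction and is dropped afterwards\<close>
  have "(1 - \<beta>) * (\<Sum>t<T. a t) + a T \<le> (\<Sum>t<T. q t) / (1 - \<beta>)"
  proof (induction T)
    case 0
    show ?case by (simp add: a_def mom_avg_0)
  next
    case (Suc T)
    show ?case using Suc step[of T] by (simp add: algebra_simps add_divide_distrib)
  qed
  moreover have "0 \<le> a T" by (simp add: a_def)
  ultimately have "(1 - \<beta>) * (\<Sum>t<T. a t) \<le> (\<Sum>t<T. q t) / (1 - \<beta>)" by linarith
  hence "(\<Sum>t<T. a t) \<le> (\<Sum>t<T. q t) / (1 - \<beta>) / (1 - \<beta>)"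
    using \<beta> by (simp add: pos_le_divide_eq mult_ac)
  thus ?thesis
    by (simp add: a_def q_def power2_eq_square)
qed

text \<open>
  Summing before taking expectations leaves only the two end values of \<open>f\<close>, and the last one is
  bounded below. The random variables \<open>f (aux s t)\<close> thus never have to be integrated.
\<close>
lemma objective_decrease_along_aux:
  assumes diff: "\<And>x. f differentiable (at x)"
    and lip: "L-lipschitz_on UNIV (gradient f)"
  shows "f (aux s T) - f xhat
    \<le> (\<Sum>t<T. L * (\<gamma> / (1 - \<beta>))\<^sup>2 / 2 * (norm (sgrad_avg s t))\<^sup>2
             - \<gamma> / (1 - \<beta>) * (gradient f (aux s t) \<bullet> sgrad_avg s t))"
proof (induction T)
  case 0
  show ?case by (simp add: aux_0)
next
  case (Suc T)
  have "f (aux s (Suc T)) \<le> f (aux s T) + gradient f (aux s T) \<bullet> (aux s (Suc T) - aux s T)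
      + L / 2 * (norm (aux s (Suc T) - aux s T))\<^sup>2"
    by (rule lipschitz_gradient_descent[OF diff lip])
  also have "aux s (Suc T) - aux s T = - ((\<gamma> / (1 - \<beta>)) *\<^sub>R sgrad_avg s T)"
    by (simp add: aux_Suc)
  finally have "f (aux s (Suc T)) \<le> f (aux s T) + (L * (\<gamma> / (1 - \<beta>))\<^sup>2 / 2 * (norm (sgrad_avg s T))\<^sup>2
      - \<gamma> / (1 - \<beta>) * (gradient f (aux s T) \<bullet> sgrad_avg s T))"
    by (simp add: power_mult_distrib power_divide)
  thus ?case using Suc by simp
qed

text \<open>
  Passing from \<open>z = aux s t\<close> to \<open>x = iter_avg s t\<close> costs \<open>L * norm (x - z) * norm h\<close>, which is
  \<open>L * \<gamma> * \<beta>\<^sup>2\<close> times a product \<open>p * q\<close> of norms. Young's inequality is applied in the form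
  \<open>\<beta>\<^sup>2 * p * q \<le> \<beta> / 2 * (p\<^sup>2 + \<beta>\<^sup>2 * q\<^sup>2)\<close>: it avoids a division by \<open>\<beta>\<close>, and it produces the
  coefficients \<open>\<beta>\<close> and \<open>\<beta> ^ 3\<close> that fit the condition on the learning rate. The remaining terms
  are the polarization identity.
\<close>
lemma neg_inner_gradient_aux_le:
  assumes lip: "L-lipschitz_on UNIV (gradient f)" and \<gamma>: "0 < \<gamma>"
  shows "- (gradient f (aux s t) \<bullet> h)
    \<le> L * \<gamma> / 2 * (\<beta> * (norm (mom_avg s t))\<^sup>2 + \<beta> ^ 3 * (norm h)\<^sup>2 / (1 - \<beta>)\<^sup>2)
      - (norm (gradient f (iter_avg s t)))\<^sup>2 / 2 - (norm h)\<^sup>2 / 2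
      + (norm (gradient f (iter_avg s t) - h))\<^sup>2 / 2"
proof -
  let ?G = "gradient f (iter_avg s t)" and ?Gz = "gradient f (aux s t)"
  define x where "x = norm (mom_avg s t)"
  define y where "y = norm h / (1 - \<beta>)"
  have L: "0 \<le> L" using lip by (rule lipschitz_on_nonneg)
  have "(?G - ?Gz) \<bullet> h \<le> norm (?G - ?Gz) * norm h"
    by (rule norm_cauchy_schwarz)
  also have "\<dots> \<le> (L * norm (iter_avg s t - aux s t)) * norm h"
    using lipschitz_onD[OF lip, of "iter_avg s t" "aux s t"]
    by (intro mult_right_mono) (simp_all add: dist_norm)
  also have "\<dots> = L * \<gamma> * (\<beta> * (x * (\<beta> * y)))"
    using \<beta> \<gamma> by (simp add: aux_def x_def y_def power2_eq_square)
  also have "\<dots> \<le> L * \<gamma> * (\<beta> * ((x\<^sup>2 + (\<beta> * y)\<^sup>2) / 2))"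
    using L \<gamma> \<beta> sum_squares_bound[of x "\<beta> * y"] by (intro mult_left_mono) auto
  also have "\<dots> = L * \<gamma> / 2 * (\<beta> * x\<^sup>2 + \<beta> ^ 3 * y\<^sup>2)"
    by (simp add: power_mult_distrib field_simps power2_eq_square power3_eq_cube)
  finally have 1: "(?G - ?Gz) \<bullet> h \<le> L * \<gamma> / 2 * (\<beta> * x\<^sup>2 + \<beta> ^ 3 * y\<^sup>2)" .
  have 2: "- (?G \<bullet> h) = (norm (?G - h))\<^sup>2 / 2 - (norm ?G)\<^sup>2 / 2 - (norm h)\<^sup>2 / 2"
    by (simp add: power2_norm_eq_inner inner_diff_left inner_diff_right inner_commute field_simps)
  have 3: "- (?Gz \<bullet> h) = (?G - ?Gz) \<bullet> h + - (?G \<bullet> h)"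
    by (simp add: inner_diff_left)
  show ?thesis
    using 1 unfolding 3 2 x_def y_def power_divide by simp
qed

end

section \<open>The stochastic process\<close>

lemma integrable_worker_avg:
  fixes Y :: "nat \<Rightarrow> 'w \<Rightarrow> real"
  assumes "\<And>i. i \<in> {1..N} \<Longrightarrow> integrable M (Y i)"
  shows "integrable M (\<lambda>\<omega>. worker_avg N (\<lambda>i. Y i \<omega>))"
    and "(\<integral>\<omega>. worker_avg N (\<lambda>i. Y i \<omega>) \<partial>M) = worker_avg N (\<lambda>i. \<integral>\<omega>. Y i \<omega> \<partial>M)"
proof -
  show "integrable M (\<lambda>\<omega>. worker_avg N (\<lambda>i. Y i \<omega>))"
    unfolding worker_avg_def
    by (intro integrable_scaleR_right Bochner_Integration.integrable_sum assms)
  show "(\<integral>\<omega>. worker_avg N (\<lambda>i. Y i \<omega>) \<partial>M) = worker_avg N (\<lambda>i. \<integral>\<omega>. Y i \<omega> \<partial>M)"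
    unfolding worker_avg_def integral_scaleR_right
    by (simp only: Bochner_Integration.integral_sum assms)
qed

lemma borel_measurable_worker_avg:
  fixes Y :: "nat \<Rightarrow> 'w \<Rightarrow> 'a::euclidean_space"
  assumes "\<And>i. i \<in> {1..N} \<Longrightarrow> Y i \<in> borel_measurable S"
  shows "(\<lambda>\<omega>. worker_avg N (\<lambda>i. Y i \<omega>)) \<in> borel_measurable S"
  unfolding worker_avg_def by (intro borel_measurable_scaleR borel_measurable_sum borel_measurable_const assms)

locale nesterov_sgd = prob_space M + nesterov_dynamics N I \<beta> \<gamma> F xhat
  for M :: "'w measure" and N I :: nat and \<beta> \<gamma> :: real
    and F :: "nat \<Rightarrow> 'a::euclidean_space \<Rightarrow> 's \<Rightarrow> real" and xhat :: 'a +
  fixes D :: "nat \<Rightarrow> 's measure" and \<xi> :: "nat \<Rightarrow> nat \<Rightarrow> 'w \<Rightarrow> 's" and L \<sigma> \<kappa> :: real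
  assumes F_diff: "\<And>i s x. i \<in> {1..N} \<Longrightarrow> s \<in> space (D i) \<Longrightarrow> (\<lambda>y. F i y s) differentiable (at x)"
    and F_meas: "\<And>i x. i \<in> {1..N} \<Longrightarrow> F i x \<in> borel_measurable (D i)"
    and D_prob: "\<And>i. i \<in> {1..N} \<Longrightarrow> prob_space (D i)"
    and unbiased: "\<And>i x. i \<in> {1..N} \<Longrightarrow> integrable (D i) (\<lambda>s. gradient (\<lambda>y. F i y s) x)"
      "\<And>i x. i \<in> {1..N} \<Longrightarrow>
        (\<integral>s. gradient (\<lambda>y. F i y s) x \<partial>D i) = gradient (local_objective D F i) x"
    and local_lip: "\<And>i. i \<in> {1..N} \<Longrightarrow> L-lipschitz_on UNIV (gradient (local_objective D F i))"
    and variance: "\<And>i x. i \<in> {1..N} \<Longrightarrow> integrable (D i)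
        (\<lambda>s. (norm (gradient (\<lambda>y. F i y s) x - gradient (local_objective D F i) x))\<^sup>2)"
      "\<And>i x. i \<in> {1..N} \<Longrightarrow>
        (\<integral>s. (norm (gradient (\<lambda>y. F i y s) x - gradient (local_objective D F i) x))\<^sup>2 \<partial>D i) \<le> \<sigma>\<^sup>2"
    and heterogeneity: "\<And>x. worker_avg N (\<lambda>i. (norm (gradient (local_objective D F i) x
        - worker_avg N (\<lambda>i. gradient (local_objective D F i) x)))\<^sup>2) \<le> \<kappa>\<^sup>2"
    and indep: "indep_vars (\<lambda>(i, t). D i) (\<lambda>(i, t). \<xi> i t) ({1..N} \<times> UNIV)"
    and sample_distr: "\<And>i t. i \<in> {1..N} \<Longrightarrow> distr M (D i) (\<xi> i t) = D i"
begin

abbreviation path :: "'w \<Rightarrow> nat \<Rightarrow> nat \<Rightarrow> 's" where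
  "path \<omega> \<equiv> \<lambda>i t. \<xi> i t \<omega>"

abbreviation grad :: "nat \<Rightarrow> 'a \<Rightarrow> 'a" where
  "grad i \<equiv> gradient (local_objective D F i)"

text \<open>
  The exact local gradient at the worker's own iterate, which is the conditional mean of the
  stochastic gradient.
\<close>
definition egrad :: "nat \<Rightarrow> nat \<Rightarrow> 'w \<Rightarrow> 'a" where
  "egrad t i \<omega> = grad i (iter (path \<omega>) t i)"

definition noise :: "nat \<Rightarrow> nat \<Rightarrow> 'w \<Rightarrow> 'a" where
  "noise t i \<omega> = sgrad (path \<omega>) t i - egrad t i \<omega>"

abbreviation past :: "(nat \<times> nat) set \<Rightarrow> 'w measure" where
  "past J \<equiv> history (\<lambda>(i, t). D i) (\<lambda>(i, t). \<xi> i t) J"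

lemma sgrad_eq: "sgrad (path \<omega>) t i = noise t i \<omega> + egrad t i \<omega>"
  by (simp add: noise_def)

lemma L_nonneg: "0 \<le> L"
  using local_lip[of 1] N by (auto intro: lipschitz_on_nonneg)

lemma measurable_sample: "i \<in> {1..N} \<Longrightarrow> \<xi> i t \<in> measurable M (D i)"
  using indep by (auto simp: indep_vars_def)

lemma measurable_sample_past:
  assumes "J \<subseteq> {1..N} \<times> UNIV" "(i, t) \<in> J"
  shows "\<xi> i t \<in> measurable (past J) (D i)"
proof -
  have "(\<lambda>(i, t). \<xi> i t) p \<in> measurable M ((\<lambda>(i, t). D i) p)" if "p \<in> J" for p
    using that assms(1) measurable_sample by auto
  from measurable_history[of J "\<lambda>(i, t). \<xi> i t" "\<lambda>(i, t). D i", OF this assms(2)] show ?thesis by simp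
qed

lemma measurable_grad: "i \<in> {1..N} \<Longrightarrow> grad i \<in> borel_measurable borel"
  using lipschitz_on_continuous_on[OF local_lip] by (intro borel_measurable_continuous_onI)

lemma measurable_stochastic_gradient:
  assumes i: "i \<in> {1..N}" and X: "X \<in> borel_measurable S" and Z: "Z \<in> measurable S (D i)"
  shows "(\<lambda>\<omega>. gradient (\<lambda>y. F i y (Z \<omega>)) (X \<omega>)) \<in> borel_measurable S"
  using measurable_compose[OF measurable_Pair[OF X Z] borel_measurable_gradient_pair[of "F i"]]
    F_meas[OF i] F_diff[OF i] by simp

text \<open>
  The sigma-algebra is left open: it only has to make the earlier samples measurable. The lemma
  is used for sigma-algebras generated by some of the samples.
\<close>
lemma measurable_state:
  fixes S :: "'w measure"
  assumes "\<And>i k. i \<in> {1..N} \<Longrightarrow> k < t \<Longrightarrow> \<xi> i k \<in> measurable S (D i)" and "i \<in> {1..N}"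
  shows "(\<lambda>\<omega>. mom (path \<omega>) t i) \<in> borel_measurable S"
    and "(\<lambda>\<omega>. iter (path \<omega>) t i) \<in> borel_measurable S"
proof -
  have "(\<lambda>\<omega>. mom (path \<omega>) t i) \<in> borel_measurable S \<and> (\<lambda>\<omega>. iter (path \<omega>) t i) \<in> borel_measurable S"
    using assms
  proof (induction t arbitrary: i)
    case 0
    show ?case by (simp add: mom_0 iter_0)
  next
    case (Suc t)
    have IH: "(\<lambda>\<omega>. mom (path \<omega>) t i) \<in> borel_measurable S"
      "(\<lambda>\<omega>. iter (path \<omega>) t i) \<in> borel_measurable S" if "i \<in> {1..N}" for i
      using Suc.IH[OF _ that] Suc.prems(1) by auto
    have g: "(\<lambda>\<omega>. sgrad (path \<omega>) t i) \<in> borel_measurable S" if "i \<in> {1..N}" for i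
      unfolding sgrad_def using that
      by (intro measurable_stochastic_gradient IH Suc.prems(1)) auto
    have u: "(\<lambda>\<omega>. \<beta> *\<^sub>R mom (path \<omega>) t i + sgrad (path \<omega>) t i) \<in> borel_measurable S"
      if "i \<in> {1..N}" for i
      using IH[OF that] g[OF that] by measurable
    have x: "(\<lambda>\<omega>. iter (path \<omega>) t i
        - \<gamma> *\<^sub>R (\<beta>\<^sup>2 *\<^sub>R mom (path \<omega>) t i + (1 + \<beta>) *\<^sub>R sgrad (path \<omega>) t i)) \<in> borel_measurable S"
      if "i \<in> {1..N}" for i
      using IH[OF that] g[OF that] by measurable
    show ?case
      using u[OF Suc.prems(2)] x[OF Suc.prems(2)] borel_measurable_worker_avg[OF u]
        borel_measurable_worker_avg[OF x]
      by (cases "I dvd Suc t") (simp_all only: state_Suc if_True if_False)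
  qed
  thus "(\<lambda>\<omega>. mom (path \<omega>) t i) \<in> borel_measurable S"
    "(\<lambda>\<omega>. iter (path \<omega>) t i) \<in> borel_measurable S" by auto
qed

lemma measurable_state_past:
  assumes J: "J \<subseteq> {1..N} \<times> UNIV" "{1..N} \<times> {..<t} \<subseteq> J" and i: "i \<in> {1..N}"
  shows "(\<lambda>\<omega>. mom (path \<omega>) t i) \<in> borel_measurable (past J)"
    and "(\<lambda>\<omega>. iter (path \<omega>) t i) \<in> borel_measurable (past J)"
    and "egrad t i \<in> borel_measurable (past J)"
proof -
  have samples: "\<xi> i k \<in> measurable (past J) (D i)" if "i \<in> {1..N}" "k < t" for i k
    using J that by (intro measurable_sample_past) auto
  show "(\<lambda>\<omega>. mom (path \<omega>) t i) \<in> borel_measurable (past J)"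
    and iter: "(\<lambda>\<omega>. iter (path \<omega>) t i) \<in> borel_measurable (past J)"
    using measurable_state[OF samples i] by auto
  show "egrad t i \<in> borel_measurable (past J)"
    unfolding egrad_def[abs_def] by (rule measurable_compose[OF iter measurable_grad[OF i]])
qed

text \<open>
  The set \<open>J\<close> of known samples must contain all earlier ones, since these determine the iterate,
  and must not contain the sample that generates the noise. It may contain samples of other
  workers drawn in the same iteration.
\<close>
lemma
  assumes J: "J \<subseteq> {1..N} \<times> UNIV" "{1..N} \<times> {..<t} \<subseteq> J" "(i, t) \<notin> J" and i: "i \<in> {1..N}"
  shows square_integrable_noise_given_past: "square_integrable M (noise t i)"
    and integral_norm_sq_noise_le_given_past: "(\<integral>\<omega>. (norm (noise t i \<omega>))\<^sup>2 \<partial>M) \<le> \<sigma>\<^sup>2"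
    and noise_orthogonal_past: "\<And>Z. Z \<in> borel_measurable (past J) \<Longrightarrow> square_integrable M Z \<Longrightarrow>
      (\<integral>\<omega>. noise t i \<omega> \<bullet> Z \<omega> \<partial>M) = 0"
proof -
  define \<psi> where "\<psi> \<omega> s = gradient (\<lambda>y. F i y s) (iter (path \<omega>) t i) - egrad t i \<omega>" for \<omega> s
  have noise: "noise t i = (\<lambda>\<omega>. \<psi> \<omega> (\<xi> i t \<omega>))"
    by (simp add: fun_eq_iff noise_def sgrad_def \<psi>_def)
  note fresh = distr_history_sample[OF indep J(1) _ J(3), simplified]
  have id: "(\<lambda>\<omega>. \<omega>) \<in> measurable M (past J)"
    and joint: "distr M (past J \<Otimes>\<^sub>M D i) (\<lambda>\<omega>. (\<omega>, \<xi> i t \<omega>))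
      = distr M (past J) (\<lambda>\<omega>. \<omega>) \<Otimes>\<^sub>M distr M (D i) (\<xi> i t)"
    using fresh i by auto
  have "(\<lambda>p. gradient (\<lambda>y. F i y (snd p)) (iter (path (fst p)) t i)) \<in> borel_measurable (past J \<Otimes>\<^sub>M D i)"
    by (intro measurable_stochastic_gradient i
        measurable_compose[OF measurable_fst measurable_state_past(2)[OF J(1,2) i]]) measurable
  moreover have "(\<lambda>p. egrad t i (fst p)) \<in> borel_measurable (past J \<Otimes>\<^sub>M D i)"
    by (rule measurable_compose[OF measurable_fst measurable_state_past(3)[OF J(1,2) i]])
  ultimately have \<psi>: "(\<lambda>(\<omega>, s). \<psi> \<omega> s) \<in> borel_measurable (past J \<Otimes>\<^sub>M D i)"
    unfolding \<psi>_def split_beta' by (rule borel_measurable_diff)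
  have var: "integrable (D i) (\<lambda>s. (norm (\<psi> \<omega> s))\<^sup>2)" "(\<integral>s. (norm (\<psi> \<omega> s))\<^sup>2 \<partial>D i) \<le> \<sigma>\<^sup>2" for \<omega>
    using variance[OF i] by (auto simp: \<psi>_def egrad_def)
  interpret D: prob_space "D i" using D_prob[OF i] .
  have mean: "integrable (D i) (\<psi> \<omega>)" "(\<integral>s. \<psi> \<omega> s \<partial>D i) = 0" for \<omega>
    using unbiased[OF i] by (auto simp: \<psi>_def[abs_def] egrad_def D.prob_space)
  note facts = id measurable_sample[OF i] joint sample_distr[OF i] \<psi> var
  show "square_integrable M (noise t i)"
    unfolding noise by (rule square_integrable_fresh_noise[OF facts])
  show "(\<integral>\<omega>. (norm (noise t i \<omega>))\<^sup>2 \<partial>M) \<le> \<sigma>\<^sup>2"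
    unfolding noise by (rule integral_norm_sq_fresh_noise_le[OF facts])
  show "(\<integral>\<omega>. noise t i \<omega> \<bullet> Z \<omega> \<partial>M) = 0"
    if "Z \<in> borel_measurable (past J)" "square_integrable M Z" for Z
    unfolding noise by (rule integral_inner_fresh_noise_eq_0[OF facts mean that])
qed

lemma
  assumes "i \<in> {1..N}"
  shows square_integrable_noise: "square_integrable M (noise t i)"
    and integral_norm_sq_noise_le: "(\<integral>\<omega>. (norm (noise t i \<omega>))\<^sup>2 \<partial>M) \<le> \<sigma>\<^sup>2"
  using square_integrable_noise_given_past[of "{1..N} \<times> {..<t}" t i]
    integral_norm_sq_noise_le_given_past[of "{1..N} \<times> {..<t}" t i] assms by auto

text \<open>
  Of two noise vectors one is not earlier than the other. It is compared with the history of all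
  samples up to its iteration except its own, which determines the other noise vector.
\<close>
lemma noise_orthogonal_noise:
  assumes i: "i \<in> {1..N}" and j: "j \<in> {1..N}" and ne: "(t, i) \<noteq> (r, j)"
  shows "(\<integral>\<omega>. noise t i \<omega> \<bullet> noise r j \<omega> \<partial>M) = 0"
proof -
  have *: "(\<integral>\<omega>. noise t i \<omega> \<bullet> noise r j \<omega> \<partial>M) = 0"
    if "i \<in> {1..N}" "j \<in> {1..N}" "(t, i) \<noteq> (r, j)" "r \<le> t" for t r i j
  proof -
    let ?J = "{1..N} \<times> {..t} - {(i, t)}"
    have J: "?J \<subseteq> {1..N} \<times> UNIV" "{1..N} \<times> {..<t} \<subseteq> ?J" "{1..N} \<times> {..<r} \<subseteq> ?J" "(i, t) \<notin> ?J"
      using that by auto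
    have "(\<lambda>\<omega>. sgrad (path \<omega>) r j) \<in> borel_measurable (past ?J)"
      unfolding sgrad_def using that J
      by (intro measurable_stochastic_gradient measurable_state_past measurable_sample_past) auto
    hence "noise r j \<in> borel_measurable (past ?J)"
      unfolding noise_def[abs_def] using measurable_state_past(3)[OF J(1,3) that(2)]
      by (rule borel_measurable_diff)
    thus ?thesis
      using noise_orthogonal_past[OF J(1,2,4) that(1)] square_integrable_noise[OF that(2)] by blast
  qed
  show ?thesis
  proof (cases "r \<le> t")
    case True
    thus ?thesis using * assms by blast
  next
    case False
    thus ?thesis using *[of j i r t] assms by (auto simp: inner_commute)
  qed
qed

text \<open>
  Each step adds noise, which is square-integrable by the variance bound, and exact gradients,
  which inherit the property from the iterates because they are Lipschitz functions of them.
\<close>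
lemma square_integrable_state:
  assumes "i \<in> {1..N}"
  shows "square_integrable M (\<lambda>\<omega>. mom (path \<omega>) t i)"
    and "square_integrable M (\<lambda>\<omega>. iter (path \<omega>) t i)"
proof -
  have "square_integrable M (\<lambda>\<omega>. mom (path \<omega>) t i) \<and> square_integrable M (\<lambda>\<omega>. iter (path \<omega>) t i)"
    using assms
  proof (induction t arbitrary: i)
    case 0
    show ?case by (simp add: mom_0 iter_0 square_integrable_const)
  next
    case (Suc t)
    have IH: "square_integrable M (\<lambda>\<omega>. mom (path \<omega>) t i)"
      "square_integrable M (\<lambda>\<omega>. iter (path \<omega>) t i)" if "i \<in> {1..N}" for i
      using Suc.IH[OF that] by auto
    have g: "square_integrable M (\<lambda>\<omega>. sgrad (path \<omega>) t i)" if "i \<in> {1..N}" for i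
      unfolding sgrad_eq egrad_def using that
      by (intro square_integrable_add square_integrable_noise square_integrable_lipschitz[OF local_lip] IH)
    have u: "square_integrable M (\<lambda>\<omega>. \<beta> *\<^sub>R mom (path \<omega>) t i + sgrad (path \<omega>) t i)"
      if "i \<in> {1..N}" for i
      by (intro square_integrable_add square_integrable_scaleR IH g that)
    have x: "square_integrable M (\<lambda>\<omega>. iter (path \<omega>) t i
        - \<gamma> *\<^sub>R (\<beta>\<^sup>2 *\<^sub>R mom (path \<omega>) t i + (1 + \<beta>) *\<^sub>R sgrad (path \<omega>) t i))"
      if "i \<in> {1..N}" for i
      by (intro square_integrable_add square_integrable_diff square_integrable_scaleR IH g that)
    show ?case
      using u[OF Suc.prems] x[OF Suc.prems] square_integrable_worker_avg[OF u]
        square_integrable_worker_avg[OF x]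
      by (cases "I dvd Suc t") (simp_all only: state_Suc if_True if_False)
  qed
  thus "square_integrable M (\<lambda>\<omega>. mom (path \<omega>) t i)"
    "square_integrable M (\<lambda>\<omega>. iter (path \<omega>) t i)" by auto
qed

lemma square_integrable_egrad: "i \<in> {1..N} \<Longrightarrow> square_integrable M (egrad t i)"
  unfolding egrad_def[abs_def]
  by (intro square_integrable_lipschitz[OF local_lip] square_integrable_state)

definition noise_avg :: "nat \<Rightarrow> 'w \<Rightarrow> 'a" where
  "noise_avg t \<omega> = worker_avg N (\<lambda>i. noise t i \<omega>)"

definition egrad_avg :: "nat \<Rightarrow> 'w \<Rightarrow> 'a" where
  "egrad_avg t \<omega> = worker_avg N (\<lambda>i. egrad t i \<omega>)"

lemma sgrad_avg_eq: "sgrad_avg (path \<omega>) t = noise_avg t \<omega> + egrad_avg t \<omega>"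
  unfolding sgrad_avg_def noise_avg_def egrad_avg_def worker_avg_add[symmetric] sgrad_eq[symmetric] ..

lemma square_integrable_averages:
  "square_integrable M (noise_avg t)" "square_integrable M (egrad_avg t)"
  "square_integrable M (\<lambda>\<omega>. sgrad_avg (path \<omega>) t)"
  "square_integrable M (\<lambda>\<omega>. mom_avg (path \<omega>) t)" "square_integrable M (\<lambda>\<omega>. iter_avg (path \<omega>) t)"
proof -
  show n: "square_integrable M (noise_avg t)"
    unfolding noise_avg_def[abs_def] by (intro square_integrable_worker_avg square_integrable_noise)
  show e: "square_integrable M (egrad_avg t)"
    unfolding egrad_avg_def[abs_def] by (intro square_integrable_worker_avg square_integrable_egrad)
  show "square_integrable M (\<lambda>\<omega>. sgrad_avg (path \<omega>) t)"
    unfolding sgrad_avg_eq by (rule square_integrable_add[OF n e])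
  show "square_integrable M (\<lambda>\<omega>. mom_avg (path \<omega>) t)"
    unfolding mom_avg_def by (intro square_integrable_worker_avg square_integrable_state)
  show "square_integrable M (\<lambda>\<omega>. iter_avg (path \<omega>) t)"
    unfolding iter_avg_def by (intro square_integrable_worker_avg square_integrable_state)
qed

lemma square_integrable_aux: "square_integrable M (\<lambda>\<omega>. aux (path \<omega>) t)"
  unfolding aux_def
  by (intro square_integrable_diff square_integrable_scaleR square_integrable_averages)

lemma noise_avg_orthogonal_past:
  assumes Z: "Z \<in> borel_measurable (past ({1..N} \<times> {..<t}))" and sq: "square_integrable M Z"
  shows "(\<integral>\<omega>. noise_avg t \<omega> \<bullet> Z \<omega> \<partial>M) = 0"
proof -
  have "(\<integral>\<omega>. noise t i \<omega> \<bullet> Z \<omega> \<partial>M) = 0" if "i \<in> {1..N}" for i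
    using that by (intro noise_orthogonal_past[OF _ _ _ that Z sq]) auto
  hence "worker_avg N (\<lambda>i. \<integral>\<omega>. noise t i \<omega> \<bullet> Z \<omega> \<partial>M) = 0"
    by (simp add: worker_avg_def)
  moreover have "integrable M (\<lambda>\<omega>. noise t i \<omega> \<bullet> Z \<omega>)" if "i \<in> {1..N}" for i
    by (intro integrable_inner_square_integrable square_integrable_noise that sq)
  ultimately show ?thesis
    by (simp only: noise_avg_def worker_avg_inner_left integrable_worker_avg(2))
qed

text \<open>
  The noises of the workers are orthogonal, so their squared norms add up to at most \<open>N * \<sigma>\<^sup>2\<close>,
  while averaging divides by \<open>N\<^sup>2\<close>. This is where the linear speedup comes from.
\<close>
lemma integral_norm_sq_noise_avg_le: "(\<integral>\<omega>. (norm (noise_avg t \<omega>))\<^sup>2 \<partial>M) \<le> \<sigma>\<^sup>2 / real N"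
proof -
  have "(\<integral>\<omega>. (norm (noise_avg t \<omega>))\<^sup>2 \<partial>M)
      = (1 / real N)\<^sup>2 * (\<integral>\<omega>. (norm (\<Sum>i = 1..N. noise t i \<omega>))\<^sup>2 \<partial>M)"
    by (simp add: noise_avg_def worker_avg_def power_divide)
  also have "(\<integral>\<omega>. (norm (\<Sum>i = 1..N. noise t i \<omega>))\<^sup>2 \<partial>M)
      = (\<Sum>i = 1..N. \<integral>\<omega>. (norm (noise t i \<omega>))\<^sup>2 \<partial>M)"
    by (intro integral_norm_sq_sum_orthogonal square_integrable_noise noise_orthogonal_noise) auto
  also have "\<dots> \<le> (\<Sum>i = 1..N. \<sigma>\<^sup>2)"
    by (intro sum_mono integral_norm_sq_noise_le)
  finally show ?thesis
    using N by (simp add: mult_left_mono power2_eq_square field_simps)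
qed

lemma integral_norm_sq_sgrad_avg_le:
  "(\<integral>\<omega>. (norm (sgrad_avg (path \<omega>) t))\<^sup>2 \<partial>M)
     \<le> \<sigma>\<^sup>2 / real N + (\<integral>\<omega>. (norm (egrad_avg t \<omega>))\<^sup>2 \<partial>M)"
proof -
  have "egrad_avg t \<in> borel_measurable (past ({1..N} \<times> {..<t}))"
    unfolding egrad_avg_def[abs_def]
    by (intro borel_measurable_worker_avg measurable_state_past) auto
  hence orth: "(\<integral>\<omega>. noise_avg t \<omega> \<bullet> egrad_avg t \<omega> \<partial>M) = 0"
    by (intro noise_avg_orthogonal_past square_integrable_averages)
  have "(\<integral>\<omega>. (norm (sgrad_avg (path \<omega>) t))\<^sup>2 \<partial>M) = (\<integral>\<omega>. (norm (noise_avg t \<omega>))\<^sup>2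
      + 2 * (noise_avg t \<omega> \<bullet> egrad_avg t \<omega>) + (norm (egrad_avg t \<omega>))\<^sup>2 \<partial>M)"
    unfolding sgrad_avg_eq
    by (simp add: power2_norm_eq_inner inner_add_left inner_add_right inner_commute algebra_simps)
  also have "\<dots> = (\<integral>\<omega>. (norm (noise_avg t \<omega>))\<^sup>2 \<partial>M) + 2 * (\<integral>\<omega>. noise_avg t \<omega> \<bullet> egrad_avg t \<omega> \<partial>M)
      + (\<integral>\<omega>. (norm (egrad_avg t \<omega>))\<^sup>2 \<partial>M)"
    by (simp add: square_integrable_norm_sq integrable_inner_square_integrable square_integrable_averages)
  finally show ?thesis
    using integral_norm_sq_noise_avg_le[of t] by (simp add: orth)
qed

text \<open>
  The auxiliary iterate is determined by the samples before iteration \<open>t\<close>, so the noise part of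
  the stochastic gradient drops out.
\<close>
lemma integral_inner_sgrad_avg:
  assumes lip: "K-lipschitz_on UNIV \<phi>"
  shows "(\<integral>\<omega>. \<phi> (aux (path \<omega>) t) \<bullet> sgrad_avg (path \<omega>) t \<partial>M)
    = (\<integral>\<omega>. \<phi> (aux (path \<omega>) t) \<bullet> egrad_avg t \<omega> \<partial>M)"
proof -
  let ?Z = "\<lambda>\<omega>. \<phi> (aux (path \<omega>) t)"
  have sq: "square_integrable M ?Z"
    by (rule square_integrable_lipschitz[OF lip square_integrable_aux])
  have "(\<lambda>\<omega>. aux (path \<omega>) t) \<in> borel_measurable (past ({1..N} \<times> {..<t}))"
    unfolding aux_def iter_avg_def mom_avg_def
    by (intro borel_measurable_diff borel_measurable_scaleR borel_measurable_const
        borel_measurable_worker_avg measurable_state_past) auto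
  hence "?Z \<in> borel_measurable (past ({1..N} \<times> {..<t}))"
    by (rule borel_measurable_continuous_on[OF lipschitz_on_continuous_on[OF lip]])
  hence "(\<integral>\<omega>. noise_avg t \<omega> \<bullet> ?Z \<omega> \<partial>M) = 0"
    using sq by (rule noise_avg_orthogonal_past)
  thus ?thesis
    by (simp add: sgrad_avg_eq inner_add_right integrable_inner_square_integrable sq
        square_integrable_averages inner_commute)
qed

section \<open>The expected drift\<close>

lemma integrable_drift: "integrable M (\<lambda>\<omega>. drift (path \<omega>) t)"
  unfolding drift_def
  by (intro integrable_worker_avg square_integrable_norm_sq square_integrable_diff
      square_integrable_state square_integrable_averages)

lemma integral_norm_sq_weighted_noise_le:
  assumes i: "i \<in> {1..N}"
  shows "(\<integral>\<omega>. (norm (\<Sum>k<j. weight (j - k) *\<^sub>R noise (t0 + k) i \<omega>))\<^sup>2 \<partial>M)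
    \<le> real j * \<sigma>\<^sup>2 / (1 - \<beta>)\<^sup>2"
proof -
  have "(\<integral>\<omega>. (norm (\<Sum>k<j. weight (j - k) *\<^sub>R noise (t0 + k) i \<omega>))\<^sup>2 \<partial>M)
      = (\<Sum>k<j. \<integral>\<omega>. (norm (weight (j - k) *\<^sub>R noise (t0 + k) i \<omega>))\<^sup>2 \<partial>M)"
    using i by (intro integral_norm_sq_sum_orthogonal square_integrable_scaleR square_integrable_noise)
      (simp_all add: noise_orthogonal_noise)
  also have "\<dots> = (\<Sum>k<j. (weight (j - k))\<^sup>2 * (\<integral>\<omega>. (norm (noise (t0 + k) i \<omega>))\<^sup>2 \<partial>M))"
    by (simp add: power_mult_distrib)
  also have "\<dots> \<le> (\<Sum>k<j. 1 / (1 - \<beta>)\<^sup>2 * \<sigma>\<^sup>2)"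
    by (intro sum_mono mult_mono weight_bounds integral_norm_sq_noise_le i) auto
  finally show ?thesis by simp
qed

lemma integral_drift_recursion:
  assumes sync: "I dvd t0" and j: "j < I"
  shows "(\<integral>\<omega>. drift (path \<omega>) (t0 + j) \<partial>M)
    \<le> 2 * \<gamma>\<^sup>2 * real j * \<sigma>\<^sup>2 / (1 - \<beta>)\<^sup>2
      + 2 * \<gamma>\<^sup>2 * real j / (1 - \<beta>)\<^sup>2 *
        (\<Sum>k<j. 2 * L\<^sup>2 * (\<integral>\<omega>. drift (path \<omega>) (t0 + k) \<partial>M) + 2 * \<kappa>\<^sup>2)"
proof -
  define A where "A i \<omega> = (norm (\<Sum>k<j. weight (j - k) *\<^sub>R noise (t0 + k) i \<omega>))\<^sup>2" for i \<omega>
  have A_int: "integrable M (A i)" if "i \<in> {1..N}" for i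
    unfolding A_def using that
    by (intro square_integrable_norm_sq square_integrable_sum square_integrable_scaleR square_integrable_noise)
  have A_le: "(\<integral>\<omega>. worker_avg N (\<lambda>i. A i \<omega>) \<partial>M) \<le> real j * \<sigma>\<^sup>2 / (1 - \<beta>)\<^sup>2"
  proof -
    have "worker_avg N (\<lambda>i. \<integral>\<omega>. A i \<omega> \<partial>M) \<le> worker_avg N (\<lambda>i. real j * \<sigma>\<^sup>2 / (1 - \<beta>)\<^sup>2)"
      unfolding A_def by (intro worker_avg_mono integral_norm_sq_weighted_noise_le)
    moreover have "(\<integral>\<omega>. worker_avg N (\<lambda>i. A i \<omega>) \<partial>M) = worker_avg N (\<lambda>i. \<integral>\<omega>. A i \<omega> \<partial>M)"
      by (rule integrable_worker_avg(2)[OF A_int])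
    ultimately show ?thesis
      by (simp only: worker_avg_const[OF N])
  qed
  have drift_le: "drift (path \<omega>) (t0 + j) \<le> 2 * \<gamma>\<^sup>2 * worker_avg N (\<lambda>i. A i \<omega>)
      + 2 * \<gamma>\<^sup>2 * real j / (1 - \<beta>)\<^sup>2 * (\<Sum>k<j. 2 * L\<^sup>2 * drift (path \<omega>) (t0 + k) + 2 * \<kappa>\<^sup>2)" for \<omega>
  proof -
    have "worker_avg N (\<lambda>i. (norm (egrad t i \<omega> - worker_avg N (\<lambda>i. egrad t i \<omega>)))\<^sup>2)
        \<le> 2 * L\<^sup>2 * drift (path \<omega>) t + 2 * \<kappa>\<^sup>2" for t
      unfolding egrad_def drift_def
      by (intro order_trans[OF worker_avg_gradient_dispersion_le[OF N local_lip, where m = "iter_avg (path \<omega>) t"]]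
          add_left_mono mult_left_mono heterogeneity) auto
    hence "2 * \<gamma>\<^sup>2 * real j / (1 - \<beta>)\<^sup>2 * (\<Sum>k<j. worker_avg N (\<lambda>i. (norm (egrad (t0 + k) i \<omega>
          - worker_avg N (\<lambda>i. egrad (t0 + k) i \<omega>)))\<^sup>2))
        \<le> 2 * \<gamma>\<^sup>2 * real j / (1 - \<beta>)\<^sup>2 * (\<Sum>k<j. 2 * L\<^sup>2 * drift (path \<omega>) (t0 + k) + 2 * \<kappa>\<^sup>2)"
      by (intro mult_left_mono sum_mono) auto
    thus ?thesis
      using drift_le_noise_plus_dispersion[OF sgrad_eq sync j, of \<omega>] by (simp add: A_def)
  qed
  define W where "W \<omega> = worker_avg N (\<lambda>i. A i \<omega>)" for \<omega>
  define B where "B \<omega> = (\<Sum>k<j. 2 * L\<^sup>2 * drift (path \<omega>) (t0 + k) + 2 * \<kappa>\<^sup>2)" for \<omega>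
  have int_k: "integrable M (\<lambda>\<omega>. 2 * L\<^sup>2 * drift (path \<omega>) (t0 + k) + 2 * \<kappa>\<^sup>2)" for k
    using integrable_drift by auto
  have W_int: "integrable M W"
    unfolding W_def[abs_def] by (intro integrable_worker_avg A_int)
  have B_int: "integrable M B"
    unfolding B_def[abs_def] by (intro Bochner_Integration.integrable_sum int_k)
  have B_eq: "(\<integral>\<omega>. B \<omega> \<partial>M)
      = (\<Sum>k<j. 2 * L\<^sup>2 * (\<integral>\<omega>. drift (path \<omega>) (t0 + k) \<partial>M) + 2 * \<kappa>\<^sup>2)"
    unfolding B_def Bochner_Integration.integral_sum[OF int_k]
    using integrable_drift by (simp add: prob_space)
  have "(\<integral>\<omega>. drift (path \<omega>) (t0 + j) \<partial>M)
      \<le> (\<integral>\<omega>. 2 * \<gamma>\<^sup>2 * W \<omega> + 2 * \<gamma>\<^sup>2 * real j / (1 - \<beta>)\<^sup>2 * B \<omega> \<partial>M)"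
    using W_int B_int drift_le[folded W_def B_def] integrable_drift by (intro integral_mono) auto
  also have "\<dots> = 2 * \<gamma>\<^sup>2 * (\<integral>\<omega>. W \<omega> \<partial>M) + 2 * \<gamma>\<^sup>2 * real j / (1 - \<beta>)\<^sup>2 * (\<integral>\<omega>. B \<omega> \<partial>M)"
    using W_int B_int by simp
  also have "2 * \<gamma>\<^sup>2 * (\<integral>\<omega>. W \<omega> \<partial>M) \<le> 2 * \<gamma>\<^sup>2 * (real j * \<sigma>\<^sup>2 / (1 - \<beta>)\<^sup>2)"
    unfolding W_def by (intro mult_left_mono A_le) auto
  finally show ?thesis by (simp add: B_eq)
qed

definition drift_bound :: real where
  "drift_bound = 4 * \<gamma>\<^sup>2 * real I * \<sigma>\<^sup>2 / (1 - \<beta>)\<^sup>2 + 9 * \<gamma>\<^sup>2 * (real I)\<^sup>2 * \<kappa>\<^sup>2 / (1 - \<beta>)\<^sup>2"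

text \<open>
  Since a round starts without drift, the bound can be proved by induction over the iterations.
  If it holds for the earlier iterations of the round, then the recursion gives the constants
  \<open>2\<close> and \<open>4\<close> in place of \<open>4\<close> and \<open>9\<close>, plus \<open>4 * (L * \<gamma> * I)\<^sup>2 / (1 - \<beta>)\<^sup>2 \<le> 1 / 9\<close> times the bound
  itself, and \<open>2 + 4 / 9 \<le> 4\<close>, \<open>4 + 9 / 9 \<le> 9\<close>.
\<close>
lemma integral_drift_le:
  assumes \<gamma>: "0 < \<gamma>" and I: "I \<ge> 1" and small: "6 * L * \<gamma> * real I \<le> 1 - \<beta>"
  shows "(\<integral>\<omega>. drift (path \<omega>) t \<partial>M) \<le> drift_bound"
proof (induction t rule: less_induct)
  case (less t)
  define j where "j = t mod I"
  define t0 where "t0 = t - j"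
  have t: "t = t0 + j" and sync: "I dvd t0" and j: "j < I"
    using I by (auto simp: j_def t0_def dvd_minus_mod)
  let ?C = drift_bound
  define q where "q = (1 - \<beta>)\<^sup>2"
  have q: "q > 0" using \<beta> by (simp add: q_def)
  have C: "0 \<le> ?C" by (simp add: drift_bound_def)
  have jI: "real j \<le> real I" using j by simp
  have "(\<integral>\<omega>. drift (path \<omega>) t \<partial>M) \<le> 2 * \<gamma>\<^sup>2 * real j * \<sigma>\<^sup>2 / q
      + 2 * \<gamma>\<^sup>2 * real j / q * (\<Sum>k<j. 2 * L\<^sup>2 * (\<integral>\<omega>. drift (path \<omega>) (t0 + k) \<partial>M) + 2 * \<kappa>\<^sup>2)"
    unfolding t q_def by (rule integral_drift_recursion[OF sync j])
  also have "\<dots> \<le> 2 * \<gamma>\<^sup>2 * real I * \<sigma>\<^sup>2 / q + 2 * \<gamma>\<^sup>2 * real I / q * (\<Sum>k<j. 2 * L\<^sup>2 * ?C + 2 * \<kappa>\<^sup>2)"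
    using less jI t C q
    by (intro add_mono mult_mono divide_right_mono sum_mono mult_left_mono sum_nonneg) 
       (auto intro!: integral_nonneg_AE simp: drift_def worker_avg_def sum_nonneg)
  also have "\<dots> \<le> 2 * \<gamma>\<^sup>2 * real I * \<sigma>\<^sup>2 / q
      + 2 * \<gamma>\<^sup>2 * real I / q * (real I * (2 * L\<^sup>2 * ?C + 2 * \<kappa>\<^sup>2))"
  proof (intro add_left_mono mult_left_mono)
    show "(\<Sum>k<j. 2 * L\<^sup>2 * ?C + 2 * \<kappa>\<^sup>2) \<le> real I * (2 * L\<^sup>2 * ?C + 2 * \<kappa>\<^sup>2)"
      using jI C by (auto intro!: mult_right_mono)
  qed (use q in auto)
  also have "2 * \<gamma>\<^sup>2 * real I * \<sigma>\<^sup>2 / q + 2 * \<gamma>\<^sup>2 * real I / q * (real I * (2 * L\<^sup>2 * ?C + 2 * \<kappa>\<^sup>2))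
      = (2 * \<gamma>\<^sup>2 * real I * \<sigma>\<^sup>2 + 4 * \<gamma>\<^sup>2 * (real I)\<^sup>2 * \<kappa>\<^sup>2) / q
        + 4 * (L * \<gamma> * real I)\<^sup>2 / q * ?C"
    using q by (simp add: power2_eq_square field_simps)
  also have "\<dots> \<le> (2 * \<gamma>\<^sup>2 * real I * \<sigma>\<^sup>2 + 4 * \<gamma>\<^sup>2 * (real I)\<^sup>2 * \<kappa>\<^sup>2) / q + 1 / 9 * ?C"
  proof (intro add_left_mono mult_right_mono C)
    have "(6 * L * \<gamma> * real I)\<^sup>2 \<le> q"
      unfolding q_def using small L_nonneg \<gamma> by (intro power_mono) auto
    thus "4 * (L * \<gamma> * real I)\<^sup>2 / q \<le> 1 / 9"
      using q by (simp add: power_mult_distrib field_simps)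
  qed
  also have "\<dots> \<le> ?C"
  proof -
    define a where "a = \<gamma>\<^sup>2 * real I * \<sigma>\<^sup>2 / q"
    define b where "b = \<gamma>\<^sup>2 * (real I)\<^sup>2 * \<kappa>\<^sup>2 / q"
    have "0 \<le> a" "0 \<le> b" using q by (auto simp: a_def b_def)
    moreover have "?C = 4 * a + 9 * b"
      by (simp add: drift_bound_def a_def b_def q_def)
    moreover have "(2 * \<gamma>\<^sup>2 * real I * \<sigma>\<^sup>2 + 4 * \<gamma>\<^sup>2 * (real I)\<^sup>2 * \<kappa>\<^sup>2) / q = 2 * a + 4 * b"
      by (simp add: a_def b_def add_divide_distrib)
    ultimately show ?thesis by simp
  qed
  finally show ?case .
qed

section \<open>The convergence bound\<close>

text \<open>
  The expectation of the summed descent inequality. The noise disappears from the inner products,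
  and the distance between the gradient of \<open>f\<close> and the averaged local gradients is bounded by the
  drift \<open>R\<close>.
\<close>
lemma expected_objective_decrease:
  assumes diff: "\<And>x. f differentiable (at x)"
    and lip: "L-lipschitz_on UNIV (gradient f)"
    and grad_f: "\<And>x. gradient f x = worker_avg N (\<lambda>i. grad i x)"
    and lower: "\<And>x. fstar \<le> f x" and \<gamma>: "0 < \<gamma>"
  defines "G t \<equiv> \<integral>\<omega>. (norm (gradient f (iter_avg (path \<omega>) t)))\<^sup>2 \<partial>M"
    and "H t \<equiv> \<integral>\<omega>. (norm (egrad_avg t \<omega>))\<^sup>2 \<partial>M"
    and "W t \<equiv> \<integral>\<omega>. (norm (mom_avg (path \<omega>) t))\<^sup>2 \<partial>M"
    and "Q t \<equiv> \<integral>\<omega>. (norm (sgrad_avg (path \<omega>) t))\<^sup>2 \<partial>M"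
    and "R t \<equiv> \<integral>\<omega>. drift (path \<omega>) t \<partial>M"
  shows "fstar - f xhat \<le> (\<Sum>t<T. L * (\<gamma> / (1 - \<beta>))\<^sup>2 / 2 * Q t
    + \<gamma> / (1 - \<beta>) * (L * \<gamma> / 2 * (\<beta> * W t + \<beta> ^ 3 * H t / (1 - \<beta>)\<^sup>2)
        - G t / 2 - H t / 2 + L\<^sup>2 * R t / 2))"
proof -
  let ?\<eta> = "\<gamma> / (1 - \<beta>)"
  have \<eta>: "0 \<le> ?\<eta>" using \<gamma> \<beta> by simp
  define E where "E t \<omega> = gradient f (aux (path \<omega>) t) \<bullet> sgrad_avg (path \<omega>) t" for t \<omega>
  define E' where "E' t \<omega> = gradient f (aux (path \<omega>) t) \<bullet> egrad_avg t \<omega>" for t \<omega>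
  define P where "P t \<omega> = L * ?\<eta>\<^sup>2 / 2 * (norm (sgrad_avg (path \<omega>) t))\<^sup>2 - ?\<eta> * E t \<omega>" for t \<omega>
  note sq = square_integrable_averages square_integrable_lipschitz[OF lip square_integrable_aux]
    square_integrable_lipschitz[OF lip square_integrable_averages(5)]
  have E_int: "integrable M (E t)" "integrable M (E' t)" for t
    unfolding E_def[abs_def] E'_def[abs_def] by (intro integrable_inner_square_integrable sq)+
  have sq_int: "integrable M (\<lambda>\<omega>. (norm (sgrad_avg (path \<omega>) t))\<^sup>2)"
    "integrable M (\<lambda>\<omega>. (norm (mom_avg (path \<omega>) t))\<^sup>2)"
    "integrable M (\<lambda>\<omega>. (norm (egrad_avg t \<omega>))\<^sup>2)"
    "integrable M (\<lambda>\<omega>. (norm (gradient f (iter_avg (path \<omega>) t)))\<^sup>2)" for t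
    by (intro square_integrable_norm_sq sq)+
  have P_int: "integrable M (P t)" for t
    unfolding P_def[abs_def] using E_int sq_int by auto
  have "fstar - f xhat \<le> (\<Sum>t<T. P t \<omega>)" for \<omega>
    using objective_decrease_along_aux[OF diff lip, of "path \<omega>" T] lower[of "aux (path \<omega>) T"]
    by (simp add: P_def E_def)
  hence "(\<integral>\<omega>. fstar - f xhat \<partial>M) \<le> (\<integral>\<omega>. (\<Sum>t<T. P t \<omega>) \<partial>M)"
    using P_int by (intro integral_mono) auto
  also have "\<dots> = (\<Sum>t<T. \<integral>\<omega>. P t \<omega> \<partial>M)"
    using P_int by (intro Bochner_Integration.integral_sum)
  also have "\<dots> \<le> (\<Sum>t<T. L * ?\<eta>\<^sup>2 / 2 * Q t + ?\<eta> * (L * \<gamma> / 2 * (\<beta> * W t + \<beta> ^ 3 * H t / (1 - \<beta>)\<^sup>2)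
        - G t / 2 - H t / 2 + L\<^sup>2 * R t / 2))"
  proof (rule sum_mono)
    fix t
    let ?B = "\<lambda>\<omega>. L * \<gamma> / 2 * (\<beta> * (norm (mom_avg (path \<omega>) t))\<^sup>2
        + \<beta> ^ 3 * (norm (egrad_avg t \<omega>))\<^sup>2 / (1 - \<beta>)\<^sup>2)
      - (norm (gradient f (iter_avg (path \<omega>) t)))\<^sup>2 / 2 - (norm (egrad_avg t \<omega>))\<^sup>2 / 2
      + L\<^sup>2 * drift (path \<omega>) t / 2"
    have B_le: "- E' t \<omega> \<le> ?B \<omega>" for \<omega>
    proof -
      have "(norm (gradient f (iter_avg (path \<omega>) t) - egrad_avg t \<omega>))\<^sup>2 \<le> L\<^sup>2 * drift (path \<omega>) t"
        unfolding grad_f egrad_avg_def egrad_def drift_def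
        by (rule worker_avg_gradient_drift_le[OF N local_lip])
      thus ?thesis
        using neg_inner_gradient_aux_le[OF lip \<gamma>, of "path \<omega>" t "egrad_avg t \<omega>"]
        unfolding E'_def by linarith
    qed
    have "- (\<integral>\<omega>. E t \<omega> \<partial>M) = (\<integral>\<omega>. - E' t \<omega> \<partial>M)"
      unfolding E_def E'_def by (simp add: integral_inner_sgrad_avg[OF lip])
    also have "\<dots> \<le> (\<integral>\<omega>. ?B \<omega> \<partial>M)"
      using E_int sq_int integrable_drift by (intro integral_mono B_le) auto
    also have "\<dots> = L * \<gamma> / 2 * (\<beta> * W t + \<beta> ^ 3 * H t / (1 - \<beta>)\<^sup>2) - G t / 2 - H t / 2 + L\<^sup>2 * R t / 2"
      using sq_int integrable_drift by (simp add: G_def H_def W_def R_def)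
    finally have "?\<eta> * - (\<integral>\<omega>. E t \<omega> \<partial>M) \<le> ?\<eta> *
        (L * \<gamma> / 2 * (\<beta> * W t + \<beta> ^ 3 * H t / (1 - \<beta>)\<^sup>2) - G t / 2 - H t / 2 + L\<^sup>2 * R t / 2)"
      using \<eta> by (rule mult_left_mono)
    moreover have "(\<integral>\<omega>. P t \<omega> \<partial>M) = L * ?\<eta>\<^sup>2 / 2 * Q t + ?\<eta> * - (\<integral>\<omega>. E t \<omega> \<partial>M)"
      unfolding P_def using E_int sq_int by (simp add: Q_def)
    ultimately show "(\<integral>\<omega>. P t \<omega> \<partial>M) \<le> L * ?\<eta>\<^sup>2 / 2 * Q t
        + ?\<eta> * (L * \<gamma> / 2 * (\<beta> * W t + \<beta> ^ 3 * H t / (1 - \<beta>)\<^sup>2) - G t / 2 - H t / 2 + L\<^sup>2 * R t / 2)"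
      by linarith
  qed
  finally show ?thesis by (simp add: prob_space)
qed

text \<open>
  With \<open>c = L * \<gamma> / (1 - \<beta>)\<^sup>2\<close>, the second moments \<open>Q\<close> of the stochastic gradients occur with the
  factor \<open>c * (1 - \<beta>)\<close> from the quadratic term of the descent inequality and with the factor
  \<open>c * \<beta>\<close> from the momentum, together exactly \<open>c\<close>. Replacing \<open>Q\<close> by the variance plus the
  second moments \<open>H\<close> of the averaged exact gradients leaves
  \<open>c * (1 + \<beta> ^ 3) - 1\<close> as the coefficient of \<open>H\<close>, which the step size condition makes
  nonpositive.
\<close>
lemma average_gradient_bound:
  assumes diff: "\<And>x. f differentiable (at x)"
    and lip: "L-lipschitz_on UNIV (gradient f)"
    and grad_f: "\<And>x. gradient f x = worker_avg N (\<lambda>i. grad i x)"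
    and lower: "\<And>x. fstar \<le> f x" and \<gamma>: "0 < \<gamma>" and I: "I \<ge> 1" and T: "T > 0"
    and step: "L * \<gamma> * (1 + \<beta> ^ 3) \<le> (1 - \<beta>)\<^sup>2" and round: "6 * L * \<gamma> * real I \<le> 1 - \<beta>"
  shows "(1 / real T) * (\<Sum>t<T. \<integral>\<omega>. (norm (gradient f (iter_avg (path \<omega>) t)))\<^sup>2 \<partial>M)
    \<le> nesterov_bound L \<beta> (f xhat - fstar) \<gamma> T N I \<sigma> \<kappa>"
proof -
  define G where "G = (\<Sum>t<T. \<integral>\<omega>. (norm (gradient f (iter_avg (path \<omega>) t)))\<^sup>2 \<partial>M)"
  define H where "H = (\<Sum>t<T. \<integral>\<omega>. (norm (egrad_avg t \<omega>))\<^sup>2 \<partial>M)"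
  define W where "W = (\<Sum>t<T. \<integral>\<omega>. (norm (mom_avg (path \<omega>) t))\<^sup>2 \<partial>M)"
  define Q where "Q = (\<Sum>t<T. \<integral>\<omega>. (norm (sgrad_avg (path \<omega>) t))\<^sup>2 \<partial>M)"
  define R where "R = (\<Sum>t<T. \<integral>\<omega>. drift (path \<omega>) t \<partial>M)"
  define b where "b = 1 - \<beta>"
  have b: "0 < b" using \<beta> by (simp add: b_def)
  define c where "c = L * \<gamma> / b\<^sup>2"
  have c: "0 \<le> c" using L_nonneg \<gamma> by (simp add: c_def)
  let ?V = "real T * (\<sigma>\<^sup>2 / real N)"
  have H0: "0 \<le> H" by (simp add: H_def sum_nonneg)
  have R: "R \<le> real T * drift_bound"
    using sum_mono[of "{..<T}" "\<lambda>t. \<integral>\<omega>. drift (path \<omega>) t \<partial>M" "\<lambda>t. drift_bound"]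
      integral_drift_le[OF \<gamma> I round] by (simp add: R_def)
  have Q: "Q \<le> ?V + H"
  proof -
    have "Q \<le> (\<Sum>t<T. \<sigma>\<^sup>2 / real N + (\<integral>\<omega>. (norm (egrad_avg t \<omega>))\<^sup>2 \<partial>M))"
      unfolding Q_def by (intro sum_mono integral_norm_sq_sgrad_avg_le)
    thus ?thesis by (simp add: H_def sum.distrib)
  qed
  have W: "W \<le> Q / b\<^sup>2"
  proof -
    have int: "integrable M (\<lambda>\<omega>. (norm (mom_avg (path \<omega>) t))\<^sup>2)"
      "integrable M (\<lambda>\<omega>. (norm (sgrad_avg (path \<omega>) t))\<^sup>2)" for t
      by (intro square_integrable_norm_sq square_integrable_averages)+
    have "W = (\<integral>\<omega>. (\<Sum>t<T. (norm (mom_avg (path \<omega>) t))\<^sup>2) \<partial>M)"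
      unfolding W_def by (rule Bochner_Integration.integral_sum[OF int(1), symmetric])
    also have "\<dots> \<le> (\<integral>\<omega>. (\<Sum>t<T. (norm (sgrad_avg (path \<omega>) t))\<^sup>2) / (1 - \<beta>)\<^sup>2 \<partial>M)"
      using int by (intro integral_mono sum_norm_mom_avg_sq_le) auto
    also have "\<dots> = Q / b\<^sup>2"
      using int by (simp add: Q_def b_def)
    finally show ?thesis .
  qed
  have "fstar - f xhat \<le> L * (\<gamma> / b)\<^sup>2 / 2 * Q
      + \<gamma> / b * (L * \<gamma> / 2 * (\<beta> * W + \<beta> ^ 3 * H / b\<^sup>2) - G / 2 - H / 2 + L\<^sup>2 * R / 2)"
    using expected_objective_decrease[OF diff lip grad_f lower \<gamma>, of T]
    unfolding G_def H_def W_def Q_def R_def b_def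
    by (simp only: sum.distrib sum_subtractf sum_distrib_left[symmetric] sum_divide_distrib[symmetric])
  hence "2 * b / \<gamma> * (fstar - f xhat) \<le> 2 * b / \<gamma> * (L * (\<gamma> / b)\<^sup>2 / 2 * Q
      + \<gamma> / b * (L * \<gamma> / 2 * (\<beta> * W + \<beta> ^ 3 * H / b\<^sup>2) - G / 2 - H / 2 + L\<^sup>2 * R / 2))"
    using b \<gamma> by (intro mult_left_mono) auto
  also have "\<dots> = c * b * Q + c * b\<^sup>2 * \<beta> * W + c * \<beta> ^ 3 * H - G - H + L\<^sup>2 * R"
  proof -
    have 1: "2 * b / \<gamma> * (L * (\<gamma> / b)\<^sup>2 / 2 * Q) = c * b * Q"
      using b \<gamma> by (simp add: c_def power2_eq_square)
    have 2: "2 * b / \<gamma> * (\<gamma> / b * x) = 2 * x" for x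
      using b \<gamma> by simp
    have 3: "L * \<gamma> / 2 * (\<beta> * W + \<beta> ^ 3 * H / b\<^sup>2) = (c * b\<^sup>2 * \<beta> * W + c * \<beta> ^ 3 * H) / 2"
      using b by (simp add: c_def distrib_left mult_ac)
    show ?thesis unfolding distrib_left[of "2 * b / \<gamma>"] 1 2 3 by simp
  qed
  also have "\<dots> \<le> c * b * Q + c * b\<^sup>2 * \<beta> * (Q / b\<^sup>2) + c * \<beta> ^ 3 * H - G - H
      + L\<^sup>2 * (real T * drift_bound)"
    using c \<beta> by (intro add_mono diff_mono mult_left_mono order_refl W R) auto
  also have "\<dots> = c * (b + \<beta>) * Q + c * \<beta> ^ 3 * H - G - H + L\<^sup>2 * (real T * drift_bound)"
    using b by (simp add: distrib_left distrib_right)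
  also have "\<dots> \<le> c * (b + \<beta>) * (?V + H) + c * \<beta> ^ 3 * H - G - H + L\<^sup>2 * (real T * drift_bound)"
    using c by (intro add_mono diff_mono mult_left_mono order_refl Q) (auto simp: b_def)
  also have "\<dots> = c * ?V + (c * (1 + \<beta> ^ 3) - 1) * H - G + L\<^sup>2 * (real T * drift_bound)"
    by (simp add: b_def distrib_left distrib_right left_diff_distrib)
  finally have total: "2 * b / \<gamma> * (fstar - f xhat)
      \<le> c * ?V + (c * (1 + \<beta> ^ 3) - 1) * H - G + L\<^sup>2 * (real T * drift_bound)" .
  have "c * (1 + \<beta> ^ 3) \<le> 1"
    using step b by (simp add: c_def b_def)
  hence "(c * (1 + \<beta> ^ 3) - 1) * H \<le> 0"
    using H0 by (intro mult_nonpos_nonneg) auto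
  moreover have "2 * b / \<gamma> * (f xhat - fstar) = - (2 * b / \<gamma> * (fstar - f xhat))"
    by (simp add: right_diff_distrib)
  \<comment> \<open>variables in place of the products make the step linear\<close>
  moreover have "g \<le> p + v + d" if "h \<le> 0" "p = - q" "q \<le> v + h - g + d" for g p v d h q :: real
    using that by linarith
  ultimately have "G \<le> 2 * b / \<gamma> * (f xhat - fstar) + c * ?V + L\<^sup>2 * (real T * drift_bound)"
    using total by blast
  hence "(1 / real T) * G
      \<le> (1 / real T) * (2 * b / \<gamma> * (f xhat - fstar) + c * ?V + L\<^sup>2 * (real T * drift_bound))"
    by (intro mult_left_mono) auto
  also have "\<dots> = 2 * b / (\<gamma> * real T) * (f xhat - fstar) + c * (\<sigma>\<^sup>2 / real N) + L\<^sup>2 * drift_bound"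
    using T by (simp add: distrib_left mult_ac)
  also have "\<dots> = nesterov_bound L \<beta> (f xhat - fstar) \<gamma> T N I \<sigma> \<kappa>"
    unfolding nesterov_bound_def drift_bound_def c_def b_def by (simp add: distrib_left mult_ac)
  finally show ?thesis unfolding G_def .
qed

end

text \<open>
  Each of the four summands of the bound is a constant multiple of the corresponding function, so
  the estimate is uniform over any set of parameters.
\<close>
lemma nesterov_bound_bigo:
  "(\<lambda>(\<gamma>, T, N, I, \<sigma>, \<kappa>). nesterov_bound L \<beta> \<Delta> \<gamma> T N I \<sigma> \<kappa>)
      \<in> O[principal S](\<lambda>(\<gamma>, T, N, I, \<sigma>, \<kappa>). 1 / (\<gamma> * real T))
        + O[principal S](\<lambda>(\<gamma>, T, N, I, \<sigma>, \<kappa>). \<gamma> / real N * \<sigma>\<^sup>2)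
        + O[principal S](\<lambda>(\<gamma>, T, N, I, \<sigma>, \<kappa>). \<gamma>\<^sup>2 * real I * \<sigma>\<^sup>2)
        + O[principal S](\<lambda>(\<gamma>, T, N, I, \<sigma>, \<kappa>). \<gamma>\<^sup>2 * (real I)\<^sup>2 * \<kappa>\<^sup>2)"
proof -
  have scaled: "(\<lambda>p. c * g p) \<in> O[principal S](g)" for c :: real and g :: "'b \<Rightarrow> real" and S
    by (rule bigoI[of _ "\<bar>c\<bar>"]) (simp add: abs_mult)
  have "(\<lambda>(\<gamma>, T, N, I, \<sigma>, \<kappa>). nesterov_bound L \<beta> \<Delta> \<gamma> T N I \<sigma> \<kappa>) =
      (\<lambda>p. 2 * (1 - \<beta>) * \<Delta> * (\<lambda>(\<gamma>, T, N, I, \<sigma>, \<kappa>). 1 / (\<gamma> * real T)) p)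
      + (\<lambda>p. L / (1 - \<beta>)\<^sup>2 * (\<lambda>(\<gamma>, T, N, I, \<sigma>, \<kappa>). \<gamma> / real N * \<sigma>\<^sup>2) p)
      + (\<lambda>p. 4 * L\<^sup>2 / (1 - \<beta>)\<^sup>2 * (\<lambda>(\<gamma>, T, N, I, \<sigma>, \<kappa>). \<gamma>\<^sup>2 * real I * \<sigma>\<^sup>2) p)
      + (\<lambda>p. 9 * L\<^sup>2 / (1 - \<beta>)\<^sup>2 * (\<lambda>(\<gamma>, T, N, I, \<sigma>, \<kappa>). \<gamma>\<^sup>2 * (real I)\<^sup>2 * \<kappa>\<^sup>2) p)"
    by (auto simp: fun_eq_iff nesterov_bound_def mult_ac)
  also have "\<dots> \<in> O[principal S](\<lambda>(\<gamma>, T, N, I, \<sigma>, \<kappa>). 1 / (\<gamma> * real T))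
        + O[principal S](\<lambda>(\<gamma>, T, N, I, \<sigma>, \<kappa>). \<gamma> / real N * \<sigma>\<^sup>2)
        + O[principal S](\<lambda>(\<gamma>, T, N, I, \<sigma>, \<kappa>). \<gamma>\<^sup>2 * real I * \<sigma>\<^sup>2)
        + O[principal S](\<lambda>(\<gamma>, T, N, I, \<sigma>, \<kappa>). \<gamma>\<^sup>2 * (real I)\<^sup>2 * \<kappa>\<^sup>2)"
    by (intro set_plus_intro scaled)
  finally show ?thesis .
qed

theorem theorem2:
  fixes N I T :: nat
    and D :: "nat \<Rightarrow> 's measure"
    and F :: "nat \<Rightarrow> real ^ 'm \<Rightarrow> 's \<Rightarrow> real"
    and L \<sigma> \<kappa> \<beta> \<gamma> fstar :: real
    and xhat :: "real ^ 'm"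
    and M :: "'w measure"
    and \<xi> :: "nat \<Rightarrow> nat \<Rightarrow> 'w \<Rightarrow> 's"
  defines "f \<equiv> global_objective N D F"
    and "xbar \<equiv> \<lambda>t \<omega>. avg_iterate N I \<beta> \<gamma> F xhat (\<lambda>i t. \<xi> i t \<omega>) t"
  assumes N: "N \<ge> 1"
    and D_prob: "\<forall>i\<in>{1..N}. prob_space (D i)"
    and F_diff: "\<forall>i\<in>{1..N}. \<forall>s\<in>space (D i). \<forall>x. (\<lambda>y. F i y s) differentiable (at x)"
    and F_integrable: "\<forall>i\<in>{1..N}. \<forall>x. integrable (D i) (F i x)"
    and unbiased: "\<forall>i\<in>{1..N}. \<forall>x.
        integrable (D i) (\<lambda>s. gradient (\<lambda>y. F i y s) x) \<and>
        (\<integral>s. gradient (\<lambda>y. F i y s) x \<partial>D i) = gradient (local_objective D F i) x"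
    and L: "L > 0"
    and smooth: "\<forall>i\<in>{1..N}. (\<forall>x. local_objective D F i differentiable (at x)) \<and>
        L-lipschitz_on UNIV (gradient (local_objective D F i))"
    and \<sigma>: "\<sigma> > 0"
    and variance: "\<forall>i\<in>{1..N}. \<forall>x.
        integrable (D i)
          (\<lambda>s. (norm (gradient (\<lambda>y. F i y s) x - gradient (local_objective D F i) x))\<^sup>2) \<and>
        (\<integral>s. (norm (gradient (\<lambda>y. F i y s) x - gradient (local_objective D F i) x))\<^sup>2 \<partial>D i)
          \<le> \<sigma>\<^sup>2"
    and \<kappa>: "\<kappa> > 0"
    and heterogeneity: "\<forall>x.
        (1 / real N) * (\<Sum>i = 1..N. (norm (gradient (local_objective D F i) x - gradient f x))\<^sup>2)
          \<le> \<kappa>\<^sup>2"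
    and M_prob: "prob_space M"
    and samples_indep: "prob_space.indep_vars M (\<lambda>(i, t). D i) (\<lambda>(i, t). \<xi> i t) ({1..N} \<times> UNIV)"
    and samples_distr: "\<forall>i\<in>{1..N}. \<forall>t. distr M (D i) (\<xi> i t) = D i"
    and fstar: "(\<exists>xstar. f xstar = fstar) \<and> (\<forall>x. fstar \<le> f x)"
    and \<beta>: "0 \<le> \<beta>" "\<beta> < 1"
    and \<gamma>: "\<gamma> > 0" "\<gamma> \<le> (1 - \<beta>)\<^sup>2 / (L * (1 + \<beta> ^ 3))"
    and I: "I \<ge> 1" "real I \<le> (1 - \<beta>) / (6 * L * \<gamma>)"
    and T: "T > 0"
  shows "(\<forall>t<T. integrable M (\<lambda>\<omega>. (norm (gradient f (xbar t \<omega>)))\<^sup>2)) \<and>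
    (1 / real T) * (\<Sum>t<T. \<integral>\<omega>. (norm (gradient f (xbar t \<omega>)))\<^sup>2 \<partial>M)
      \<le> nesterov_bound L \<beta> (f xhat - fstar) \<gamma> T N I \<sigma> \<kappa> \<and>
    (\<lambda>(\<gamma>, T, N, I, \<sigma>, \<kappa>). nesterov_bound L \<beta> (f xhat - fstar) \<gamma> T N I \<sigma> \<kappa>)
      \<in> O[principal (admissible_params L \<beta>)](\<lambda>(\<gamma>, T, N, I, \<sigma>, \<kappa>). 1 / (\<gamma> * real T))
        + O[principal (admissible_params L \<beta>)](\<lambda>(\<gamma>, T, N, I, \<sigma>, \<kappa>). \<gamma> / real N * \<sigma>\<^sup>2)
        + O[principal (admissible_params L \<beta>)](\<lambda>(\<gamma>, T, N, I, \<sigma>, \<kappa>). \<gamma>\<^sup>2 * real I * \<sigma>\<^sup>2)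
        + O[principal (admissible_params L \<beta>)](\<lambda>(\<gamma>, T, N, I, \<sigma>, \<kappa>). \<gamma>\<^sup>2 * (real I)\<^sup>2 * \<kappa>\<^sup>2)"
proof -
  interpret prob_space M by (rule M_prob)
  have grad_f: "gradient f x = worker_avg N (\<lambda>i. gradient (local_objective D F i) x)" for x
    unfolding f_def using smooth by (intro gradient_eqI global_objective_gderiv) auto
  have diff: "f differentiable (at x)" for x
    using global_objective_gderiv[of N D F x] smooth
    unfolding f_def gderiv_def differentiable_def by blast
  have lip: "L-lipschitz_on UNIV (gradient f)"
    using lipschitz_on_worker_avg[OF N, of L UNIV "\<lambda>i. gradient (local_objective D F i)"] smooth
    unfolding grad_f[abs_def] by auto
  interpret nesterov_sgd M N I \<beta> \<gamma> F xhat D \<xi> L \<sigma> \<kappa>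
  proof (intro nesterov_sgd.intro nesterov_dynamics.intro nesterov_sgd_axioms.intro)
    show "worker_avg N (\<lambda>i. (norm (gradient (local_objective D F i) x
        - worker_avg N (\<lambda>i. gradient (local_objective D F i) x)))\<^sup>2) \<le> \<kappa>\<^sup>2" for x
      using heterogeneity unfolding grad_f by (simp add: worker_avg_def)
    show "F i x \<in> borel_measurable (D i)" if "i \<in> {1..N}" for i x
      using F_integrable that by (blast intro: borel_measurable_integrable)
    show "indep_vars (\<lambda>(i, t). D i) (\<lambda>(i, t). \<xi> i t) ({1..N} \<times> UNIV)"
      by (rule samples_indep)
    fix i x t assume i: "i \<in> {1..N}"
    show "prob_space (D i)" "L-lipschitz_on UNIV (gradient (local_objective D F i))" "distr M (D i) (\<xi> i t) = D i"
      using i D_prob smooth samples_distr by blast+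
    show "integrable (D i) (\<lambda>s. gradient (\<lambda>y. F i y s) x)"
      "(\<integral>s. gradient (\<lambda>y. F i y s) x \<partial>D i) = gradient (local_objective D F i) x"
      using bspec[OF unbiased i] by blast+
    show "integrable (D i)
        (\<lambda>s. (norm (gradient (\<lambda>y. F i y s) x - gradient (local_objective D F i) x))\<^sup>2)"
      "(\<integral>s. (norm (gradient (\<lambda>y. F i y s) x - gradient (local_objective D F i) x))\<^sup>2 \<partial>D i) \<le> \<sigma>\<^sup>2"
      using bspec[OF variance i] by blast+
    show "(\<lambda>y. F i y s) differentiable (at x)" if "s \<in> space (D i)" for s
      using F_diff i that by blast
  qed (rule M_prob N \<beta>)+
  have xbar: "xbar t \<omega> = iter_avg (path \<omega>) t" for t \<omega>
    by (simp add: xbar_def avg_iterate_def iter_avg_def iter_def)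
  have step: "L * \<gamma> * (1 + \<beta> ^ 3) \<le> (1 - \<beta>)\<^sup>2"
    using \<gamma>(2) L \<beta> by (simp add: pos_le_divide_eq add_pos_nonneg mult_ac)
  have round: "6 * L * \<gamma> * real I \<le> 1 - \<beta>"
    using I(2) L \<gamma>(1) by (simp add: pos_le_divide_eq mult_ac)
  have "integrable M (\<lambda>\<omega>. (norm (gradient f (xbar t \<omega>)))\<^sup>2)" for t
    unfolding xbar
    by (intro square_integrable_norm_sq square_integrable_lipschitz[OF lip] square_integrable_averages)
  moreover have "(1 / real T) * (\<Sum>t<T. \<integral>\<omega>. (norm (gradient f (xbar t \<omega>)))\<^sup>2 \<partial>M)
      \<le> nesterov_bound L \<beta> (f xhat - fstar) \<gamma> T N I \<sigma> \<kappa>"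
    unfolding xbar using fstar
    by (intro average_gradient_bound diff lip grad_f \<gamma>(1) I(1) T step round) auto
  ultimately show ?thesis
    using nesterov_bound_bigo by blast
qed

end
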